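(* For every graph $G$, the line graph $L(G)$ has $\tau'(G)$ completely independent spanning trees, i.e., $\tau^\ast(L(G)) \geq \tau'(G)$. Moreover, there exists a graph $G$ with $\tau'(G) > \tau(G)$ such that $\tau^\ast(L(G)) = \tau'(G)$, and there exists a graph $G$ such that $\tau^\ast(L(G)) = \tau(G)$.
   Context: All graphs are finite, simple and undirected. Spanning trees $T_1,\dots,T_k$ of a graph $H$ are completely independent if for any two distinct vertices $u,v$ of $H$, the $u$–$v$ paths in $T_1,\dots,T_k$ are pairwise edge-disjoint and pairwise share no vertex other than $u$ and $v$. $\tau^\ast(H)$ denotes the maximum number of completely independent spanning trees in $H$, and $\tau(H)$ the maximum number of edge-disjoint spanning trees in $H$. The line graph $L(G)$ has vertex set $E(G)$, two vertices being adjacent iff the corresponding edges share an endpoint. For $S \subsetneq V(G)$, $G-S$ is the graph obtained by deleting $S$, and $\langle S\rangle_G$ is the subgraph induced by $S$. For $v \in S$, $f_S(v) = \deg_G(v) - \deg_{\langle S\rangle_G}(v)$. Define $\zeta(S) = \min_{uv \in E(\langle S\rangle_G)} (f_S(u)+f_S(v))$ if $S \neq \emptyset$ and $E(\langle S\rangle_G)\neq\emptyset$, and $\zeta(S)=\infty$ otherwise. A star is a tree with at most one vertex of degree at least two. A set $S \subsetneq V(G)$ is a star-subset if $S=\emptyset$ or every component of $\langle S\rangle_G$ is a star. Define $\tau'(G) = \max_{S} \min\{\tau(G-S), \zeta(S)\}$, the maximum taken over all star-subsets $S$ of $V(G)$. *)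

theory Defs
  imports Main "HOL-Library.Extended_Nat"
begin

record 'a ugraph =
  gverts :: "'a set"
  gedges :: "'a set set"

definition fin_simple_graph :: "'a ugraph \<Rightarrow> bool" where
  "fin_simple_graph G \<longleftrightarrow>
     finite (gverts G) \<and> (\<forall>e\<in>gedges G. e \<subseteq> gverts G \<and> card e = 2)"

definition gdegree :: "'a ugraph \<Rightarrow> 'a \<Rightarrow> nat" where
  "gdegree G v = card {e \<in> gedges G. v \<in> e}"

definition induced_graph :: "'a ugraph \<Rightarrow> 'a set \<Rightarrow> 'a ugraph" where
  "induced_graph G S = \<lparr>gverts = S, gedges = {e \<in> gedges G. e \<subseteq> S}\<rparr>"

definition delete_verts :: "'a ugraph \<Rightarrow> 'a set \<Rightarrow> 'a ugraph" where
  "delete_verts G S =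
     \<lparr>gverts = gverts G - S, gedges = {e \<in> gedges G. e \<inter> S = {}}\<rparr>"

definition line_graph :: "'a ugraph \<Rightarrow> 'a set ugraph" where
  "line_graph G =
     \<lparr>gverts = gedges G,
      gedges = {{e, f} | e f. e \<in> gedges G \<and> f \<in> gedges G \<and> e \<noteq> f \<and> e \<inter> f \<noteq> {}}\<rparr>"

definition gpath_edges :: "'a list \<Rightarrow> 'a set set" where
  "gpath_edges p = {{p ! i, p ! Suc i} | i. Suc i < length p}"

definition is_gpath :: "'a ugraph \<Rightarrow> 'a \<Rightarrow> 'a list \<Rightarrow> 'a \<Rightarrow> bool" where
  "is_gpath G u p v \<longleftrightarrow>
     p \<noteq> [] \<and> hd p = u \<and> last p = v \<and> distinct p \<and>
     set p \<subseteq> gverts G \<and> gpath_edges p \<subseteq> gedges G"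

definition is_gcycle :: "'a ugraph \<Rightarrow> 'a list \<Rightarrow> bool" where
  "is_gcycle G p \<longleftrightarrow>
     length p \<ge> 3 \<and> is_gpath G (hd p) p (last p) \<and> {last p, hd p} \<in> gedges G"

text \<open>The graph without vertices is vacuously connected, hence a tree. This only matters
  for the line graph of a graph without edges.\<close>

definition gconnected :: "'a ugraph \<Rightarrow> bool" where
  "gconnected G \<longleftrightarrow> (\<forall>u\<in>gverts G. \<forall>v\<in>gverts G. \<exists>p. is_gpath G u p v)"

definition is_gtree :: "'a ugraph \<Rightarrow> bool" where
  "is_gtree G \<longleftrightarrow> gconnected G \<and> (\<nexists>p. is_gcycle G p)"

definition is_star :: "'a ugraph \<Rightarrow> bool" where
  "is_star G \<longleftrightarrow> is_gtree G \<and> card {v \<in> gverts G. gdegree G v \<ge> 2} \<le> 1"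

definition gcomponents :: "'a ugraph \<Rightarrow> 'a ugraph set" where
  "gcomponents G = (\<lambda>v. induced_graph G {w. \<exists>p. is_gpath G v p w}) ` gverts G"

definition is_spanning_tree :: "'a ugraph \<Rightarrow> 'a ugraph \<Rightarrow> bool" where
  "is_spanning_tree T G \<longleftrightarrow>
     gverts T = gverts G \<and> gedges T \<subseteq> gedges G \<and> is_gtree T"

definition edge_disjoint_trees :: "'a ugraph \<Rightarrow> 'a ugraph set \<Rightarrow> bool" where
  "edge_disjoint_trees G F \<longleftrightarrow>
     (\<forall>T\<in>F. is_spanning_tree T G) \<and> pairwise (\<lambda>T T'. gedges T \<inter> gedges T' = {}) F"

text \<open>In a tree the path between two given vertices is unique, so quantifying over all
  paths \<open>p\<close> of \<open>T\<close> and \<open>q\<close> of \<open>T'\<close> speaks about the two paths.\<close>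

definition completely_independent_trees :: "'a ugraph \<Rightarrow> 'a ugraph set \<Rightarrow> bool" where
  "completely_independent_trees G F \<longleftrightarrow>
     (\<forall>T\<in>F. is_spanning_tree T G) \<and>
     (\<forall>u\<in>gverts G. \<forall>v\<in>gverts G. u \<noteq> v \<longrightarrow>
        pairwise (\<lambda>T T'. \<forall>p q. is_gpath T u p v \<and> is_gpath T' u q v \<longrightarrow>
          gpath_edges p \<inter> gpath_edges q = {} \<and> set p \<inter> set q \<subseteq> {u, v}) F)"

text \<open>Families of trees are sets, so a graph with a single vertex (which has exactly one
  spanning tree) has value 1 for both parameters; with at least two vertices, edge-disjoint
  or completely independent trees are distinct anyway.\<close>

definition tau :: "'a ugraph \<Rightarrow> nat" where
  "tau G = Max {card F | F. edge_disjoint_trees G F}"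

definition tau_star :: "'a ugraph \<Rightarrow> nat" where
  "tau_star G = Max {card F | F. completely_independent_trees G F}"

definition outer_degree :: "'a ugraph \<Rightarrow> 'a set \<Rightarrow> 'a \<Rightarrow> nat" where
  "outer_degree G S v = gdegree G v - gdegree (induced_graph G S) v"

definition zeta :: "'a ugraph \<Rightarrow> 'a set \<Rightarrow> enat" where
  "zeta G S =
     (if S \<noteq> {} \<and> gedges (induced_graph G S) \<noteq> {}
      then enat (Min {outer_degree G S u + outer_degree G S v | u v.
                        {u, v} \<in> gedges (induced_graph G S)})
      else \<infinity>)"

definition star_subset :: "'a ugraph \<Rightarrow> 'a set \<Rightarrow> bool" where
  "star_subset G S \<longleftrightarrow>
     S \<subset> gverts G \<and> (S = {} \<or> (\<forall>C\<in>gcomponents (induced_graph G S). is_star C))"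

definition tau' :: "'a ugraph \<Rightarrow> enat" where
  "tau' G = Max {min (enat (tau (delete_verts G S))) (zeta G S) | S. star_subset G S}"

end

theory Submission
  imports Defs
begin

text \<open>
  Let \<open>k = min (\<tau>(G - S)) (\<zeta>(S))\<close> for a star-subset \<open>S\<close>, and take edge-disjoint spanning trees
  \<open>T\<^sub>1, \<dots>, T\<^sub>k\<close> of \<open>G - S\<close>. The edge sets of the \<open>T\<^sub>i\<close> are disjoint connected classes of vertices of
  \<open>L(G)\<close>. Root all \<open>T\<^sub>i\<close> at the same vertex, so that every edge has a child end and a parent end. For
  \<open>i < j\<close> an edge of \<open>T\<^sub>j\<close> is attached to the class of \<open>T\<^sub>i\<close> through the edge of \<open>T\<^sub>i\<close> with the same child end,
  whereas an edge of \<open>T\<^sub>i\<close> is attached to the class of \<open>T\<^sub>j\<close> at its parent end; in a simple graph these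
  two choices never use the same edge of \<open>L(G)\<close>. Since \<open>S\<close> induces a forest, hence a bipartite
  graph, and \<open>\<zeta>(S) \<ge> k\<close>, the edges between \<open>S\<close> and \<open>G - S\<close> can be distributed over the classes in such
  a way that every edge inside \<open>S\<close> meets each class.

  For sharpness, completely independent trees are edge-disjoint, so counting edges of the line graph
  bounds their number: \<open>K\<^sub>4\<close> has \<open>\<tau>\<^sup>*(L(K\<^sub>4)) = \<tau>(K\<^sub>4) = 2\<close>, and attaching a pendant edge to \<open>K\<^sub>4\<close>
  lowers \<open>\<tau>\<close> to \<open>1\<close> while \<open>\<tau>'\<close> and \<open>\<tau>\<^sup>*\<close> of the line graph remain \<open>2\<close>.
\<close>

section \<open>Paths, trees and forests\<close>

text \<open>Connectivity is handled through the reflexive transitive closure of this relation, that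
  is by walks, where repeated vertices do no harm; \<open>is_gpath\<close> insists on distinct
  vertices.\<close>

definition adj_rel :: "'a set set \<Rightarrow> ('a \<times> 'a) set" where
  "adj_rel E = {(x, y). {x, y} \<in> E}"

text \<open>The well-formedness that turns walks into paths. It also applies to line graphs and to
  auxiliary subgraphs.\<close>

definition edges_within :: "'a ugraph \<Rightarrow> bool" where
  "edges_within G \<longleftrightarrow> (\<forall>e\<in>gedges G. e \<subseteq> gverts G)"

lemma adj_rel_iff [simp]: "(x, y) \<in> adj_rel E \<longleftrightarrow> {x, y} \<in> E"
  by (simp add: adj_rel_def)

lemma adj_rel_mono: "E \<subseteq> E' \<Longrightarrow> (adj_rel E)\<^sup>* \<subseteq> (adj_rel E')\<^sup>*"
  by (intro rtrancl_mono) (auto simp: adj_rel_def)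

lemma sym_adj_rel: "sym ((adj_rel E)\<^sup>*)"
  by (intro sym_rtrancl) (auto simp: sym_def insert_commute)

lemma adj_rtrancl_sym: "(x, y) \<in> (adj_rel E)\<^sup>* \<Longrightarrow> (y, x) \<in> (adj_rel E)\<^sup>*"
  by (rule symD[OF sym_adj_rel])

lemma card_two_eq:
  assumes "card e = 2" "card f = 2" "x \<in> e" "x \<in> f" "y \<in> e" "y \<in> f" "x \<noteq> y"
  shows "e = f"
  using assms by (auto simp: card_2_iff)

lemma gpath_edges_singleton [simp]: "gpath_edges [x] = {}"
  by (simp add: gpath_edges_def)

lemma gpath_edges_Cons:
  assumes "p \<noteq> []"
  shows "gpath_edges (x # p) = insert {x, hd p} (gpath_edges p)"
proof -
  have "{i. Suc i < length (x # p)} = insert 0 (Suc ` {i. Suc i < length p})"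
  proof (rule set_eqI)
    fix i show "i \<in> {i. Suc i < length (x # p)} \<longleftrightarrow> i \<in> insert 0 (Suc ` {i. Suc i < length p})"
      using assms by (cases i) auto
  qed
  moreover have "gpath_edges q = (\<lambda>i. {q ! i, q ! Suc i}) ` {i. Suc i < length q}" for q :: "'a list"
    by (auto simp: gpath_edges_def)
  ultimately show ?thesis
    using assms by (simp add: image_image hd_conv_nth)
qed

lemma gpath_edges_append_left: "gpath_edges xs \<subseteq> gpath_edges (xs @ ys)"
  by (force simp: gpath_edges_def nth_append)

lemma gpath_edges_snoc:
  assumes "p \<noteq> []"
  shows "gpath_edges (p @ [z]) = insert {last p, z} (gpath_edges p)"
  using assms
proof (induction p rule: list_nonempty_induct)
  case (cons x xs)
  then show ?case by (auto simp: gpath_edges_Cons)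
qed (simp add: gpath_edges_Cons)

lemma gpath_edges_subset_set: "e \<in> gpath_edges p \<Longrightarrow> e \<subseteq> set p"
  by (auto simp: gpath_edges_def)

lemma gpath_edges_imp_rtrancl:
  assumes "p \<noteq> []" "gpath_edges p \<subseteq> E"
  shows "(hd p, last p) \<in> (adj_rel E)\<^sup>*"
  using assms
proof (induction p rule: list_nonempty_induct)
  case (cons x xs)
  then have "(x, hd xs) \<in> adj_rel E" "(hd xs, last xs) \<in> (adj_rel E)\<^sup>*"
    by (auto simp: gpath_edges_Cons)
  then show ?case using cons by (auto intro: converse_rtrancl_into_rtrancl)
qed simp

lemma is_gpath_imp_rtrancl: "is_gpath G u p v \<Longrightarrow> (u, v) \<in> (adj_rel (gedges G))\<^sup>*"
  using gpath_edges_imp_rtrancl[of p "gedges G"] by (auto simp: is_gpath_def)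

lemma is_gpath_prefix:
  assumes "is_gpath G u p v" "z \<in> set p"
  shows "\<exists>q. is_gpath G u q z"
proof -
  obtain xs ys where p: "p = (xs @ [z]) @ ys"
    using assms(2) by (auto dest: split_list)
  have "gpath_edges (xs @ [z]) \<subseteq> gpath_edges p"
    using gpath_edges_append_left unfolding p by blast
  moreover have "hd p = hd (xs @ [z])"
    unfolding p by (cases xs) auto
  ultimately have "is_gpath G u (xs @ [z]) z"
    using assms(1) p by (auto simp: is_gpath_def)
  then show ?thesis by blast
qed

lemma rtrancl_imp_is_gpath:
  assumes "(u, v) \<in> (adj_rel (gedges G))\<^sup>*" "edges_within G" "u \<in> gverts G"
  shows "\<exists>p. is_gpath G u p v"
  using assms(1)
proof (induction rule: rtrancl_induct)
  case base
  have "is_gpath G u [u] u" using assms by (simp add: is_gpath_def)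
  then show ?case ..
next
  case (step y z)
  then obtain p where p: "is_gpath G u p y" by blast
  show ?case
  proof (cases "z \<in> set p")
    case True
    \<comment> \<open>A revisited vertex ends a prefix of the path found so far, so loops are cut
      off as they arise.\<close>
    then show ?thesis using is_gpath_prefix[OF p] by blast
  next
    case False
    have "{y, z} \<in> gedges G" using step by simp
    moreover from this have "z \<in> gverts G" using assms(2) by (auto simp: edges_within_def)
    ultimately have "is_gpath G u (p @ [z]) z"
      using p False by (auto simp: is_gpath_def gpath_edges_snoc)
    then show ?thesis ..
  qed
qed

lemma gconnected_iff:
  assumes "edges_within G"
  shows "gconnected G \<longleftrightarrow>
    (\<forall>u\<in>gverts G. \<forall>v\<in>gverts G. (u, v) \<in> (adj_rel (gedges G))\<^sup>*)"
  using assms rtrancl_imp_is_gpath is_gpath_imp_rtrancl unfolding gconnected_def by metis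

lemma gconnectedD:
  assumes "gconnected G" "u \<in> gverts G" "v \<in> gverts G"
  shows "(u, v) \<in> (adj_rel (gedges G))\<^sup>*"
  using assms is_gpath_imp_rtrancl unfolding gconnected_def by metis

lemma gconnectedI_root:
  assumes "edges_within G" "\<And>u. u \<in> gverts G \<Longrightarrow> (r, u) \<in> (adj_rel (gedges G))\<^sup>*"
  shows "gconnected G"
  unfolding gconnected_iff[OF assms(1)] using assms(2) adj_rtrancl_sym by (metis rtrancl_trans)

section \<open>Cycles, spanning trees and bipartitions of forests\<close>

text \<open>A path from \<open>x\<close> to \<open>y\<close> that avoids the edge would close up
  with it to a cycle; it has at least three vertices, since the only shorter candidate is the
  removed edge itself.\<close>

lemma acyclic_edge_bridge:
  assumes "\<nexists>p. is_gcycle G p" "edges_within G" "{x, y} \<in> gedges G" "x \<noteq> y"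
  shows "(x, y) \<notin> (adj_rel (gedges G - {{x, y}}))\<^sup>*"
proof
  let ?H = "\<lparr>gverts = gverts G, gedges = gedges G - {{x, y}}\<rparr>"
  assume "(x, y) \<in> (adj_rel (gedges G - {{x, y}}))\<^sup>*"
  moreover have "edges_within ?H" "x \<in> gverts G"
    using assms by (auto simp: edges_within_def)
  ultimately obtain p where p: "is_gpath ?H x p y"
    using rtrancl_imp_is_gpath[of x y ?H] by auto
  have "length p \<ge> 3"
  proof (rule ccontr)
    assume "\<not> length p \<ge> 3"
    then obtain a b where "p = [a] \<or> p = [a, b]"
      using p by (cases p; cases "tl p"; cases "tl (tl p)") (auto simp: is_gpath_def)
    then show False using p assms(4) by (auto simp: is_gpath_def gpath_edges_Cons)
  qed
  then have "is_gcycle G p"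
    using p assms(3) by (auto simp: is_gcycle_def is_gpath_def insert_commute)
  then show False using assms(1) by blast
qed

text \<open>The first and the last index of a list of at least three distinct vertices are not
  consecutive. Hence the closing edge of a cycle can be deleted while the rest still joins its
  ends.\<close>

lemma gcycle_closing_edge:
  assumes "is_gcycle G p"
  shows "{last p, hd p} \<notin> gpath_edges p"
proof
  assume "{last p, hd p} \<in> gpath_edges p"
  then obtain i where i: "Suc i < length p" "{last p, hd p} = {p ! i, p ! Suc i}"
    by (auto simp: gpath_edges_def)
  have d: "distinct p" "length p \<ge> 3" "p \<noteq> []"
    using assms by (auto simp: is_gcycle_def is_gpath_def)
  have "{p ! (length p - 1), p ! 0} = {p ! i, p ! Suc i}"
    using i d by (simp add: last_conv_nth hd_conv_nth)
  moreover have "p ! (length p - 1) \<noteq> p ! i"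
    using nth_eq_iff_index_eq[OF d(1), of "length p - 1" i] i(1) by simp
  ultimately have "p ! 0 = p ! i" "p ! (length p - 1) = p ! Suc i"
    by (metis doubleton_eq_iff)+
  then have "0 = i" "length p - 1 = Suc i"
    using nth_eq_iff_index_eq[OF d(1), of 0 i] nth_eq_iff_index_eq[OF d(1), of "length p - 1" "Suc i"]
      i(1) d(3) by simp_all
  then show False using d by simp
qed

text \<open>A connecting edge set of least cardinality is acyclic: the closing edge of a cycle could
  be replaced by the rest of the cycle.\<close>

lemma spanning_tree_exists:
  assumes "finite (gedges G)" "edges_within G" "gconnected G"
  shows "\<exists>T. is_spanning_tree T G"
proof -
  let ?P = "\<lambda>E. E \<subseteq> gedges G \<and> gconnected \<lparr>gverts = gverts G, gedges = E\<rparr>"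
  have "?P (gedges G)" using assms(3) by (simp add: gconnected_def is_gpath_def)
  then obtain E where E: "?P E" and min: "\<And>E'. ?P E' \<Longrightarrow> card E \<le> card E'"
    using ex_has_least_nat[of ?P "gedges G" card] by blast
  let ?T = "\<lparr>gverts = gverts G, gedges = E\<rparr>"
  have "\<not> is_gcycle ?T p" for p
  proof
    assume p: "is_gcycle ?T p"
    let ?e = "{last p, hd p}"
    have e: "?e \<in> E" "p \<noteq> []" "gpath_edges p \<subseteq> E - {?e}"
      using p gcycle_closing_edge[OF p] by (auto simp: is_gcycle_def is_gpath_def)
    have path: "(hd p, last p) \<in> (adj_rel (E - {?e}))\<^sup>*"
      using e gpath_edges_imp_rtrancl by blast
    have "adj_rel E \<subseteq> (adj_rel (E - {?e}))\<^sup>*"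
    proof (rule subrelI)
      fix x y assume xy: "(x, y) \<in> adj_rel E"
      show "(x, y) \<in> (adj_rel (E - {?e}))\<^sup>*"
      proof (cases "{x, y} = ?e")
        case True
        then have "x = last p \<and> y = hd p \<or> x = hd p \<and> y = last p"
          by (simp only: doubleton_eq_iff)
        then show ?thesis using path adj_rtrancl_sym[OF path] by metis
      next
        case False
        then have "(x, y) \<in> adj_rel (E - {?e})" using xy unfolding adj_rel_def by blast
        then show ?thesis ..
      qed
    qed
    then have "(adj_rel E)\<^sup>* \<subseteq> (adj_rel (E - {?e}))\<^sup>*"
      by (rule rtrancl_subset_rtrancl)
    moreover have "edges_within \<lparr>gverts = gverts G, gedges = E - {?e}\<rparr>"
      using assms(2) E by (auto simp: edges_within_def)
    moreover have "(u, v) \<in> (adj_rel E)\<^sup>*" if "u \<in> gverts G" "v \<in> gverts G" for u v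
      using gconnectedD[of ?T u v] E that by simp
    ultimately have "gconnected \<lparr>gverts = gverts G, gedges = E - {?e}\<rparr>"
      by (subst gconnected_iff) (simp_all add: subset_iff)
    then have "?P (E - {?e})" using E by blast
    then have "card E \<le> card (E - {?e})" using min by blast
    moreover have "finite E" using E assms(1) finite_subset by blast
    ultimately show False using e(1) by (metis card_Diff1_less leD)
  qed
  then have "is_spanning_tree ?T G" using E by (simp add: is_spanning_tree_def is_gtree_def)
  then show ?thesis ..
qed

text \<open>\<open>c e\<close> is the child end of \<open>e\<close> in the tree rooted at
  \<open>r\<close>: the end that is cut off from \<open>r\<close> when \<open>e\<close> is removed.
  Surjectivity onto the non-root vertices serves both the choice of neighbours in
  \<open>L(G)\<close> and the edge count of trees.\<close>

lemma tree_child_map: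
  assumes "is_gtree T" "edges_within T" "\<And>e. e \<in> gedges T \<Longrightarrow> card e = 2" "r \<in> gverts T"
  shows "\<exists>c. (\<forall>e\<in>gedges T. c e \<in> e) \<and> c ` gedges T = gverts T - {r}"
proof -
  let ?R = "\<lambda>e. (adj_rel (gedges T - {e}))\<^sup>*"
  have "\<exists>x. x \<in> e \<and> (r, x) \<notin> ?R e" if e: "e \<in> gedges T" for e
  proof -
    obtain x y where xy: "e = {x, y}" "x \<noteq> y" using assms(3)[OF e] by (auto simp: card_2_iff)
    have "(x, y) \<notin> ?R e"
      using acyclic_edge_bridge[of T x y] assms e xy by (auto simp: is_gtree_def)
    then show ?thesis using xy by (metis insertI1 insertI2 adj_rtrancl_sym rtrancl_trans)
  qed
  then obtain c where c: "\<And>e. e \<in> gedges T \<Longrightarrow> c e \<in> e" "\<And>e. e \<in> gedges T \<Longrightarrow> (r, c e) \<notin> ?R e"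
    by metis
  have "x \<in> c ` gedges T" if x: "x \<in> gverts T" "x \<noteq> r" for x
  proof -
    obtain p where p: "is_gpath T r p x"
      using assms(1,4) x unfolding is_gtree_def gconnected_def by blast
    then obtain q where q: "p = q @ [x]"
      by (metis append_butlast_last_id is_gpath_def)
    have "q \<noteq> []" using p q x by (auto simp: is_gpath_def)
    then have e: "{last q, x} \<in> gedges T" "x \<notin> set q" "hd q = r" "gpath_edges q \<subseteq> gedges T"
      using p q by (auto simp: is_gpath_def gpath_edges_snoc)
    \<comment> \<open>The path to \<open>x\<close> without its last edge does not touch
      \<open>x\<close>, so \<open>last q\<close> stays reachable from \<open>r\<close> and
      \<open>x\<close> must be the child end.\<close>
    have "gpath_edges q \<subseteq> gedges T - {{last q, x}}"
      using e gpath_edges_subset_set[of _ q] by blast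
    then have "(r, last q) \<in> ?R {last q, x}"
      using gpath_edges_imp_rtrancl \<open>q \<noteq> []\<close> e(3) by blast
    then have "c {last q, x} = x" using c[OF e(1)] by auto
    then show ?thesis using e(1) by force
  qed
  moreover have "c e \<in> gverts T - {r}" if "e \<in> gedges T" for e
    using c[OF that] assms(2) that by (auto simp: edges_within_def)
  ultimately show ?thesis using c(1) by (intro exI[of _ c]) auto
qed

text \<open>Edges are added one by one. In a forest each new edge joins two different components of
  the edges added before, so the colours of one of them may be flipped.\<close>

lemma forest_two_colouring:
  assumes "finite (gedges G)" "edges_within G" "\<And>e. e \<in> gedges G \<Longrightarrow> card e = 2" "\<nexists>p. is_gcycle G p"
  shows "\<exists>c :: 'a \<Rightarrow> bool. \<forall>x y. {x, y} \<in> gedges G \<longrightarrow> c x \<noteq> c y"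
proof -
  have "\<exists>c :: 'a \<Rightarrow> bool. \<forall>x y. {x, y} \<in> E \<longrightarrow> c x \<noteq> c y" if "finite E" "E \<subseteq> gedges G" for E
    using that
  proof (induction E)
    case (insert e E)
    then obtain c :: "'a \<Rightarrow> bool" where c: "\<And>x y. {x, y} \<in> E \<Longrightarrow> c x \<noteq> c y" by auto
    obtain a b where ab: "e = {a, b}" "a \<noteq> b"
      using assms(3)[of e] insert by (auto simp: card_2_iff)
    have "(a, b) \<notin> (adj_rel (gedges G - {{a, b}}))\<^sup>*"
      using acyclic_edge_bridge[OF assms(4,2) _ ab(2)] insert.prems ab(1) by simp
    moreover have "E \<subseteq> gedges G - {{a, b}}" using insert ab by blast
    ultimately have nr: "(a, b) \<notin> (adj_rel E)\<^sup>*" using adj_rel_mono by blast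
    have extend: "\<exists>c :: 'a \<Rightarrow> bool. \<forall>x y. {x, y} \<in> insert e E \<longrightarrow> c x \<noteq> c y"
      if d: "\<And>x y. {x, y} \<in> E \<Longrightarrow> d x \<noteq> d y" "d a \<noteq> d b" for d :: "'a \<Rightarrow> bool"
    proof (intro exI[of _ d] allI impI)
      fix x y assume "{x, y} \<in> insert e E"
      then have "(x = a \<and> y = b) \<or> (x = b \<and> y = a) \<or> {x, y} \<in> E"
        unfolding ab(1) insert_iff[of "{x, y}"] doubleton_eq_iff by blast
      then show "d x \<noteq> d y" using d by metis
    qed
    show ?case
    proof (cases "c a = c b")
      case False
      then show ?thesis using c extend by blast
    next
      case True
      \<comment> \<open>Flips the component of \<open>a\<close>, to which \<open>b\<close> does not
        belong.\<close>
      define c' where "c' w = (if (a, w) \<in> (adj_rel E)\<^sup>* then \<not> c w else c w)" for w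
      have "c' x \<noteq> c' y" if "{x, y} \<in> E" for x y
      proof -
        have "(x, y) \<in> adj_rel E" "(y, x) \<in> adj_rel E" using that by (auto simp: insert_commute)
        then have "(a, x) \<in> (adj_rel E)\<^sup>* \<longleftrightarrow> (a, y) \<in> (adj_rel E)\<^sup>*"
          by (meson rtrancl.rtrancl_into_rtrancl)
        then show ?thesis using c[OF that] by (simp add: c'_def)
      qed
      moreover have "c' a \<noteq> c' b" using nr True by (simp add: c'_def)
      ultimately show ?thesis using extend by blast
    qed
  qed auto
  then show ?thesis using assms(1) by blast
qed

section \<open>Families of trees\<close>

text \<open>The edges to the predecessor and to the successor are distinct, so inner vertices of
  paths have degree at least two in the tree.\<close>

lemma gpath_inner_vertex:
  assumes "is_gpath T u p v" "w \<in> set p" "w \<noteq> u" "w \<noteq> v"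
  shows "\<exists>e\<in>gedges T. \<exists>f\<in>gedges T. e \<noteq> f \<and> w \<in> e \<and> w \<in> f"
proof -
  obtain i where i: "i < length p" "p ! i = w" using assms(2) by (auto simp: in_set_conv_nth)
  have p: "p \<noteq> []" "p ! 0 = u" "p ! (length p - 1) = v" "distinct p" "gpath_edges p \<subseteq> gedges T"
    using assms(1) by (auto simp: is_gpath_def hd_conv_nth last_conv_nth)
  have "i \<noteq> 0" "i \<noteq> length p - 1" using i(2) p(2,3) assms(3,4) by metis+
  then obtain j where j: "i = Suc j" "Suc i < length p" using i by (cases i) auto
  have "{p ! j, p ! i} \<in> gpath_edges p" "{p ! i, p ! Suc i} \<in> gpath_edges p"
    using i j by (auto simp: gpath_edges_def)
  moreover have "p ! j \<noteq> p ! i" "p ! j \<noteq> p ! Suc i"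
    using nth_eq_iff_index_eq[OF p(4), of j i] nth_eq_iff_index_eq[OF p(4), of j "Suc i"] i(1) j
    by simp_all
  ultimately show ?thesis using p(5) i(2)
    by (intro bexI[of _ "{p ! j, p ! i}"] bexI[of _ "{p ! i, p ! Suc i}"]) auto
qed

text \<open>The standard criterion: the trees are edge-disjoint and every vertex is a non-leaf in at
  most one of them. \<open>I T\<close> is any set containing the non-leaves of
  \<open>T\<close>.\<close>

lemma completely_independent_treesI:
  assumes span: "\<And>T. T \<in> F \<Longrightarrow> is_spanning_tree T G"
    and disj: "\<And>T T'. T \<in> F \<Longrightarrow> T' \<in> F \<Longrightarrow> T \<noteq> T' \<Longrightarrow> gedges T \<inter> gedges T' = {}"
    and inner: "\<And>T w e f. T \<in> F \<Longrightarrow> e \<in> gedges T \<Longrightarrow> f \<in> gedges T \<Longrightarrow> e \<noteq> f \<Longrightarrow>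
      w \<in> e \<Longrightarrow> w \<in> f \<Longrightarrow> w \<in> I T"
    and I: "\<And>T T'. T \<in> F \<Longrightarrow> T' \<in> F \<Longrightarrow> T \<noteq> T' \<Longrightarrow> I T \<inter> I T' = {}"
  shows "completely_independent_trees G F"
  unfolding completely_independent_trees_def
proof (intro conjI ballI impI pairwiseI allI)
  fix u v T T' p q
  assume T: "T \<in> F" "T' \<in> F" "T \<noteq> T'" and pq: "is_gpath T u p v \<and> is_gpath T' u q v"
  then show "gpath_edges p \<inter> gpath_edges q = {}"
    using disj[OF T] unfolding is_gpath_def by blast
  have "w \<in> I T \<inter> I T'" if "w \<in> set p \<inter> set q" "w \<noteq> u" "w \<noteq> v" for w
    using gpath_inner_vertex[of T u p v w] gpath_inner_vertex[of T' u q v w] that pq T inner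
    by blast
  then show "set p \<inter> set q \<subseteq> {u, v}" using I[OF T] by blast
qed (use span in blast)

text \<open>Vertices outside a class hang as leaves at their chosen neighbours; the trees stay edge-disjoint
  because no edge is chosen from both of its ends.\<close>

lemma completely_independent_trees_from_classes:
  fixes L :: "'b ugraph" and V :: "nat \<Rightarrow> 'b set" and a :: "nat \<Rightarrow> 'b \<Rightarrow> 'b"
  assumes fin: "finite (gedges L)" and wf: "edges_within L"
    and card2: "\<And>e. e \<in> gedges L \<Longrightarrow> card e = 2"
    and two: "x1 \<in> gverts L" "x2 \<in> gverts L" "x1 \<noteq> x2"
    and sub: "\<And>i. i < k \<Longrightarrow> V i \<subseteq> gverts L"
    and disj: "\<And>i j. i < k \<Longrightarrow> j < k \<Longrightarrow> i \<noteq> j \<Longrightarrow> V i \<inter> V j = {}"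
    and conn: "\<And>i. i < k \<Longrightarrow> gconnected (induced_graph L (V i))"
    and a: "\<And>i x. i < k \<Longrightarrow> x \<in> gverts L - V i \<Longrightarrow> a i x \<in> V i \<and> {x, a i x} \<in> gedges L"
    and no_mutual: "\<And>i j x y. i < k \<Longrightarrow> j < k \<Longrightarrow> i \<noteq> j \<Longrightarrow> x \<in> V j \<Longrightarrow> y \<in> V i \<Longrightarrow>
      a i x = y \<Longrightarrow> a j y = x \<Longrightarrow> False"
  shows "\<exists>F. completely_independent_trees L F \<and> card F = k"
proof -
  \<comment> \<open>The edges inside the class, and one hanging edge for every vertex outside
    it.\<close>
  define E where "E i = {e \<in> gedges L. e \<subseteq> V i} \<union> (\<lambda>x. {x, a i x}) ` (gverts L - V i)" for i
  define H where "H i = \<lparr>gverts = gverts L, gedges = E i\<rparr>" for i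
  have EL: "E i \<subseteq> gedges L" if "i < k" for i using a[OF that] by (auto simp: E_def)
  have wfH: "edges_within (H i)" if "i < k" for i
    using EL[OF that] wf by (auto simp: H_def edges_within_def)
  have connH: "gconnected (H i)" if i: "i < k" for i
  proof -
    \<comment> \<open>The class is nonempty: either \<open>x1\<close> lies in it or its chosen
      neighbour does.\<close>
    have "\<exists>r. r \<in> V i" using a[OF i, of x1] two(1) by blast
    then obtain r where r: "r \<in> V i" ..
    have in_V: "(r, x) \<in> (adj_rel (E i))\<^sup>*" if "x \<in> V i" for x
    proof -
      have "(r, x) \<in> (adj_rel {e \<in> gedges L. e \<subseteq> V i})\<^sup>*"
        using gconnectedD[OF conn[OF i], of r x] r that by (simp add: induced_graph_def)
      then show ?thesis using adj_rel_mono[of "{e \<in> gedges L. e \<subseteq> V i}" "E i"] by (auto simp: E_def)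
    qed
    have "(r, x) \<in> (adj_rel (E i))\<^sup>*" if x: "x \<in> gverts L" for x
    proof (cases "x \<in> V i")
      case False
      then have "(x, a i x) \<in> adj_rel (E i)" using x by (auto simp: E_def)
      then have "(a i x, x) \<in> adj_rel (E i)" by (simp add: insert_commute)
      moreover have "a i x \<in> V i" using a[OF i, of x] x False by blast
      ultimately show ?thesis using in_V by (meson rtrancl.rtrancl_into_rtrancl)
    qed (rule in_V)
    then show ?thesis using gconnectedI_root[OF wfH[OF i], of r] by (simp add: H_def)
  qed
  have "\<exists>T. is_spanning_tree T (H i)" if "i < k" for i
    using spanning_tree_exists[OF _ wfH[OF that] connH[OF that]] finite_subset[OF EL[OF that] fin]
    by (simp add: H_def)
  then obtain T where T: "\<And>i. i < k \<Longrightarrow> is_spanning_tree (T i) (H i)" by metis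
  have TE: "gedges (T i) \<subseteq> E i" if "i < k" for i
    using T[OF that] by (simp add: is_spanning_tree_def H_def)
  have span: "is_spanning_tree (T i) L" if "i < k" for i
    using T[OF that] EL[OF that] by (auto simp: is_spanning_tree_def H_def)
  have E_disj: "E i \<inter> E j = {}" if ij: "i < k" "j < k" "i \<noteq> j" for i j
  proof (rule ccontr)
    assume "E i \<inter> E j \<noteq> {}"
    then obtain e where e: "e \<in> E i" "e \<in> E j" by blast
    have D: "V i \<inter> V j = {}" by (rule disj[OF ij])
    have "e \<noteq> {}" using card2[of e] EL[OF ij(1)] e(1) by auto
    \<comment> \<open>Each of \<open>E i\<close> and \<open>E j\<close> contains \<open>e\<close> as
      an inner or as a hanging edge. Disjointness of the classes excludes all combinations except
      two hanging edges in opposite directions, which \<open>no_mutual\<close> forbids.\<close>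
    consider "e \<subseteq> V i" "e \<subseteq> V j" | y where "e \<subseteq> V i" "e = {y, a j y}" "y \<in> gverts L - V j"
      | x where "e \<subseteq> V j" "e = {x, a i x}" "x \<in> gverts L - V i"
      | x y where "e = {x, a i x}" "x \<in> gverts L - V i" "e = {y, a j y}" "y \<in> gverts L - V j"
      using e unfolding E_def by blast
    then show False
    proof cases
      case 1
      then show ?thesis using D \<open>e \<noteq> {}\<close> by blast
    next
      case 2
      then show ?thesis using D a[OF ij(2), of y] by blast
    next
      case 3
      then show ?thesis using D a[OF ij(1), of x] by blast
    next
      case 4
      have V: "a i x \<in> V i" "a j y \<in> V j" using a ij 4 by blast+
      have "x = y \<and> a i x = a j y \<or> x = a j y \<and> a i x = y"
        using 4 by (metis doubleton_eq_iff)
      then show ?thesis using V D no_mutual[OF ij, of x y] by (metis disjoint_iff)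
    qed
  qed
  have T_disj: "gedges (T i) \<inter> gedges (T j) = {}" if "i < k" "j < k" "i \<noteq> j" for i j
    using E_disj[OF that] TE that by blast
  have nonempty: "gedges (T i) \<noteq> {}" if "i < k" for i
  proof
    assume "gedges (T i) = {}"
    then have "(x1, x2) \<in> (adj_rel {})\<^sup>*"
      using gconnectedD[of "T i" x1 x2] span[OF that] two by (simp add: is_spanning_tree_def is_gtree_def)
    then show False using two(3) by (simp add: adj_rel_def)
  qed
  have inner: "w \<in> V i"
    if i: "i < k" and ef: "e \<in> gedges (T i)" "f \<in> gedges (T i)" "e \<noteq> f" "w \<in> e" "w \<in> f" for i w e f
  proof (rule ccontr)
    assume w: "w \<notin> V i"
    \<comment> \<open>A vertex outside the class lies only on its own hanging edge, so it is a
      leaf.\<close>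
    have "g = {w, a i w}" if g: "g \<in> E i" "w \<in> g" for g
      using g w a[OF i] unfolding E_def by blast
    then show False using ef TE[OF i] by blast
  qed
  have inj: "inj_on T {..<k}"
  proof (rule inj_onI, rule ccontr)
    fix i j assume "i \<in> {..<k}" "j \<in> {..<k}" "T i = T j" "i \<noteq> j"
    then show False using T_disj[of i j] nonempty[of i] by simp
  qed
  \<comment> \<open>The criterion indexes its sets by trees, so the class number has to be recovered
    from the tree.\<close>
  let ?idx = "the_inv_into {..<k} T"
  have idx: "?idx (T i) = i" if "i < k" for i using that inj by (simp add: the_inv_into_f_f)
  have "completely_independent_trees L (T ` {..<k})"
  proof (rule completely_independent_treesI[where I = "\<lambda>S. V (?idx S)"])
    show "is_spanning_tree S L" if "S \<in> T ` {..<k}" for S using that span by auto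
    show "gedges S \<inter> gedges S' = {}" if "S \<in> T ` {..<k}" "S' \<in> T ` {..<k}" "S \<noteq> S'" for S S'
      using that T_disj by (metis imageE lessThan_iff)
    show "w \<in> V (?idx S)" if "S \<in> T ` {..<k}" "e \<in> gedges S" "f \<in> gedges S" "e \<noteq> f" "w \<in> e" "w \<in> f"
      for S w e f
    proof -
      from that(1) obtain i where "i < k" "S = T i" by auto
      then show ?thesis using inner[of i e f w] idx[of i] that by simp
    qed
    show "V (?idx S) \<inter> V (?idx S') = {}" if "S \<in> T ` {..<k}" "S' \<in> T ` {..<k}" "S \<noteq> S'" for S S'
      using that idx disj by (metis imageE lessThan_iff)
  qed
  then show ?thesis using inj by (intro exI[of _ "T ` {..<k}"]) (simp add: card_image)
qed

section \<open>The maxima \<open>tau\<close> and \<open>tau_star\<close>\<close>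

lemma finite_spanning_trees:
  assumes "finite (gedges G)"
  shows "finite {T. is_spanning_tree T G}"
proof (rule finite_subset)
  show "{T. is_spanning_tree T G} \<subseteq> (\<lambda>E. \<lparr>gverts = gverts G, gedges = E\<rparr>) ` Pow (gedges G)"
  proof
    fix T assume "T \<in> {T. is_spanning_tree T G}"
    then show "T \<in> (\<lambda>E. \<lparr>gverts = gverts G, gedges = E\<rparr>) ` Pow (gedges G)"
      by (intro image_eqI[of _ _ "gedges T"]) (auto simp: is_spanning_tree_def)
  qed
qed (use assms in simp)

text \<open>\<open>P\<close> stands for either kind of family; finiteness makes \<open>Max\<close>
  in \<open>tau\<close> and \<open>tau_star\<close> a genuine maximum.\<close>

lemma finite_card_families:
  assumes "finite (gedges G)" "\<And>F. P F \<Longrightarrow> F \<subseteq> {T. is_spanning_tree T G}"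
  shows "finite {card F | F. P F}"
proof (rule finite_subset)
  show "{card F | F. P F} \<subseteq> card ` Pow {T. is_spanning_tree T G}" using assms(2) by auto
qed (use finite_spanning_trees[OF assms(1)] in simp)

lemma finite_card_edge_disjoint_trees:
  "finite (gedges G) \<Longrightarrow> finite {card F | F. edge_disjoint_trees G F}"
  by (rule finite_card_families) (auto simp: edge_disjoint_trees_def)

lemma finite_card_completely_independent_trees:
  "finite (gedges G) \<Longrightarrow> finite {card F | F. completely_independent_trees G F}"
  by (rule finite_card_families) (auto simp: completely_independent_trees_def)

lemma tau_attained:
  assumes "finite (gedges G)"
  shows "\<exists>F. edge_disjoint_trees G F \<and> card F = tau G"
proof -
  have "edge_disjoint_trees G {}" by (simp add: edge_disjoint_trees_def)
  then have "{card F | F. edge_disjoint_trees G F} \<noteq> {}" by blast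
  from Max_in[OF finite_card_edge_disjoint_trees[OF assms] this]
  show ?thesis by (auto simp: tau_def)
qed

lemma tau_ge: "finite (gedges G) \<Longrightarrow> edge_disjoint_trees G F \<Longrightarrow> card F \<le> tau G"
  unfolding tau_def by (rule Max_ge[OF finite_card_edge_disjoint_trees]) auto

lemma tau_le:
  assumes "finite (gedges G)" "\<And>F. edge_disjoint_trees G F \<Longrightarrow> card F \<le> n"
  shows "tau G \<le> n"
  using tau_attained[OF assms(1)] assms(2) by metis

lemma tau_star_ge: "finite (gedges G) \<Longrightarrow> completely_independent_trees G F \<Longrightarrow> card F \<le> tau_star G"
  unfolding tau_star_def by (rule Max_ge[OF finite_card_completely_independent_trees]) auto

lemma tau_star_le:
  assumes "finite (gedges G)" "\<And>F. completely_independent_trees G F \<Longrightarrow> card F \<le> n"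
  shows "tau_star G \<le> n"
proof -
  have "completely_independent_trees G {}" by (simp add: completely_independent_trees_def)
  then have "{card F | F. completely_independent_trees G F} \<noteq> {}" by blast
  then show ?thesis
    unfolding tau_star_def using assms(2)
    by (subst Max_le_iff[OF finite_card_completely_independent_trees[OF assms(1)]]) auto
qed

text \<open>Numbering the trees allows them to be compared by \<open>i < j\<close>. Injectivity is
  stated separately because an edgeless tree is edge-disjoint from itself.\<close>

lemma edge_disjoint_trees_family:
  assumes "finite (gedges G)" "k \<le> tau G"
  obtains T :: "nat \<Rightarrow> 'a ugraph" where "\<And>i. i < k \<Longrightarrow> is_spanning_tree (T i) G"
    "\<And>i j. i < k \<Longrightarrow> j < k \<Longrightarrow> i \<noteq> j \<Longrightarrow> gedges (T i) \<inter> gedges (T j) = {}"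
    "inj_on T {..<k}"
proof -
  obtain F where F: "edge_disjoint_trees G F" "card F = tau G" using tau_attained[OF assms(1)] by blast
  obtain F' where F': "F' \<subseteq> F" "card F' = k" "finite F'"
    using assms(2) F(2) obtain_subset_with_card_n by metis
  obtain T where T: "bij_betw T {..<k} F'"
    using ex_bij_betw_nat_finite[OF F'(3)] F'(2) by (auto simp: atLeast0LessThan)
  have mem: "T i \<in> F" if "i < k" for i using T F'(1) that by (auto simp: bij_betw_def)
  show ?thesis
  proof (rule that)
    show inj: "inj_on T {..<k}" using T by (simp add: bij_betw_def)
    show "is_spanning_tree (T i) G" if "i < k" for i
      using F(1) mem[OF that] by (simp add: edge_disjoint_trees_def)
    show "gedges (T i) \<inter> gedges (T j) = {}" if "i < k" "j < k" "i \<noteq> j" for i j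
    proof -
      have "T i \<noteq> T j" using inj that by (auto simp: inj_on_def)
      then show ?thesis using F(1) mem that by (auto simp: edge_disjoint_trees_def pairwise_def)
    qed
  qed
qed

section \<open>Line graphs and star-subsets\<close>

lemma line_adjacent:
  "e \<in> F \<Longrightarrow> f \<in> F \<Longrightarrow> F \<subseteq> gedges G \<Longrightarrow> e \<noteq> f \<Longrightarrow> e \<inter> f \<noteq> {} \<Longrightarrow>
    (e, f) \<in> adj_rel (gedges (induced_graph (line_graph G) F))"
  by (auto simp: line_graph_def induced_graph_def)

lemma fin_simple_graph_finite_edges:
  assumes "fin_simple_graph G"
  shows "finite (gedges G)"
  using assms finite_subset[of "gedges G" "Pow (gverts G)"] by (auto simp: fin_simple_graph_def)

lemma line_graph_finite_simple:
  assumes "fin_simple_graph G"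
  shows "finite (gedges (line_graph G))" "edges_within (line_graph G)"
    "\<And>e. e \<in> gedges (line_graph G) \<Longrightarrow> card e = 2"
proof -
  have "finite (gedges G)" by (rule fin_simple_graph_finite_edges[OF assms])
  moreover have "gedges (line_graph G) \<subseteq> Pow (gedges G)" by (auto simp: line_graph_def)
  ultimately show "finite (gedges (line_graph G))" by (metis finite_Pow_iff finite_subset)
qed (auto simp: line_graph_def edges_within_def card_2_iff)

text \<open>Consecutive edges of a walk share a vertex and are therefore adjacent in
  \<open>L(G)\<close>; thus connected edge sets become connected vertex sets of the line
  graph.\<close>

lemma line_graph_walk:
  assumes F: "F \<subseteq> gedges G" and e: "e \<in> F" "x \<in> e" and walk: "(x, y) \<in> (adj_rel F)\<^sup>*"
    and f: "f \<in> F" "y \<in> f"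
  shows "(e, f) \<in> (adj_rel (gedges (induced_graph (line_graph G) F)))\<^sup>*"
proof -
  let ?R = "adj_rel (gedges (induced_graph (line_graph G) F))"
  have meet: "(g, h) \<in> ?R\<^sup>*" if "g \<in> F" "h \<in> F" "z \<in> g" "z \<in> h" for g h z
  proof (cases "g = h")
    case False
    then have "(g, h) \<in> ?R" using line_adjacent[OF that(1,2) F] that by blast
    then show ?thesis ..
  qed simp
  have "\<forall>f. f \<in> F \<longrightarrow> y \<in> f \<longrightarrow> (e, f) \<in> ?R\<^sup>*"
    using walk
  proof (induction rule: rtrancl_induct)
    case base
    then show ?case using meet e by blast
  next
    case (step y z)
    have "{y, z} \<in> F" using step by simp
    then have "(e, {y, z}) \<in> ?R\<^sup>*" using step by blast
    then show ?case using meet[OF \<open>{y, z} \<in> F\<close>] by (meson insertI1 insertI2 rtrancl_trans)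
  qed
  then show ?thesis using f by blast
qed

section \<open>Star-subsets and their boundary edges\<close>

text \<open>A cycle lies within the component of its first vertex, and this component is a
  tree.\<close>

lemma star_subset_acyclic:
  assumes "star_subset G S"
  shows "\<nexists>p. is_gcycle (induced_graph G S) p"
proof
  let ?H = "induced_graph G S"
  assume "\<exists>p. is_gcycle ?H p"
  then obtain p where p: "is_gcycle ?H p" ..
  let ?C = "{w. \<exists>q. is_gpath ?H (hd p) q w}"
  have path: "is_gpath ?H (hd p) p (last p)" "p \<noteq> []" using p by (auto simp: is_gcycle_def)
  then have v: "hd p \<in> S" by (auto simp: is_gpath_def induced_graph_def)
  then have "is_star (induced_graph ?H ?C)"
    using assms by (auto simp: star_subset_def gcomponents_def induced_graph_def)
  moreover have "set p \<subseteq> ?C" using is_gpath_prefix[OF path(1)] by blast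
  moreover have "e \<subseteq> ?C" if "e \<in> gpath_edges p" for e
    using gpath_edges_subset_set[OF that] \<open>set p \<subseteq> ?C\<close> by blast
  moreover have "{last p, hd p} \<subseteq> ?C" using \<open>set p \<subseteq> ?C\<close> path(2) by (meson empty_subsetI hd_in_set insert_subset last_in_set subsetD)
  ultimately have "is_gcycle (induced_graph ?H ?C) p"
    using p by (auto simp: is_gcycle_def is_gpath_def induced_graph_def)
  then show False using \<open>is_star (induced_graph ?H ?C)\<close> by (auto simp: is_star_def is_gtree_def)
qed

text \<open>The subtraction in \<open>outer_degree\<close> is exact, since the induced edges at
  \<open>v\<close> are among all edges at \<open>v\<close>.\<close>

lemma outer_degree_eq:
  assumes "finite (gedges G)"
  shows "outer_degree G S v = card {e \<in> gedges G. v \<in> e \<and> \<not> e \<subseteq> S}"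
proof -
  have "{e \<in> gedges G. v \<in> e \<and> \<not> e \<subseteq> S} =
      {e \<in> gedges G. v \<in> e} - {e \<in> gedges (induced_graph G S). v \<in> e}"
    by (auto simp: induced_graph_def)
  then show ?thesis
    using assms by (simp add: outer_degree_def gdegree_def induced_graph_def card_Diff_subset subset_iff)
qed

lemma zeta_le_outer_degree:
  assumes "fin_simple_graph G" "{u, v} \<in> gedges G" "{u, v} \<subseteq> S"
  shows "zeta G S \<le> enat (outer_degree G S u + outer_degree G S v)"
proof -
  let ?E = "gedges (induced_graph G S)"
  let ?M = "{outer_degree G S u + outer_degree G S v | u v. {u, v} \<in> ?E}"
  have uv: "{u, v} \<in> ?E" using assms by (simp add: induced_graph_def)
  have "?M \<subseteq> (\<lambda>(u, v). outer_degree G S u + outer_degree G S v) ` (gverts G \<times> gverts G)"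
    using assms(1) by (force simp: induced_graph_def fin_simple_graph_def)
  moreover have "finite (gverts G)" using assms(1) by (simp add: fin_simple_graph_def)
  ultimately have "finite ?M" by (elim finite_subset) simp
  then have "Min ?M \<le> outer_degree G S u + outer_degree G S v"
    using uv by (intro Min_le) blast+
  moreover have "zeta G S = enat (Min ?M)" using uv assms(3) by (auto simp: zeta_def)
  ultimately show ?thesis by simp
qed

text \<open>One side of a bipartition of the forest induced by \<open>S\<close> colours its boundary edges
  \<open>0, 1, \<dots>\<close>, the other side \<open>k - 1, k - 2, \<dots>\<close>; an edge inside \<open>S\<close> joins the two sides, so it sees
  all colours as soon as it meets \<open>k\<close> boundary edges.\<close>

lemma boundary_colouring:
  assumes G: "fin_simple_graph G" and S: "star_subset G S" and k: "enat k \<le> zeta G S"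
  shows "\<exists>col :: 'a set \<Rightarrow> nat. \<forall>e\<in>gedges G. e \<subseteq> S \<longrightarrow>
    (\<forall>i<k. \<exists>g\<in>gedges G. g \<inter> e \<noteq> {} \<and> \<not> g \<subseteq> S \<and> col g = i)"
proof -
  let ?H = "induced_graph G S"
  have fin: "finite (gedges G)" by (rule fin_simple_graph_finite_edges[OF G])
  have card2: "card e = 2" if "e \<in> gedges G" for e using G that by (simp add: fin_simple_graph_def)
  have "finite (gedges ?H)" "edges_within ?H" "\<And>e. e \<in> gedges ?H \<Longrightarrow> card e = 2"
    using fin card2 by (auto simp: induced_graph_def edges_within_def)
  from forest_two_colouring[OF this star_subset_acyclic[OF S]]
  obtain c :: "'a \<Rightarrow> bool" where c: "\<And>x y. {x, y} \<in> gedges G \<Longrightarrow> {x, y} \<subseteq> S \<Longrightarrow> c x \<noteq> c y"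
    by (auto simp: induced_graph_def)
  define B where "B v = {e \<in> gedges G. v \<in> e \<and> \<not> e \<subseteq> S}" for v
  have "\<exists>h. bij_betw h (B v) {0..<card (B v)}" for v
    using fin by (intro ex_bij_betw_finite_nat) (simp add: B_def)
  then obtain h where h: "\<And>v. bij_betw (h v) (B v) {0..<card (B v)}" by metis
  \<comment> \<open>A boundary edge has exactly one end in \<open>S\<close>, extracted by
    \<open>the_elem\<close>. The subtraction may truncate to 0, which is harmless because colours
    only have to occur.\<close>
  define col where "col g = (let s = the_elem (g \<inter> S) in if c s then h s g else k - 1 - h s g)" for g
  have col: "col g = (if c s then h s g else k - 1 - h s g)" if "g \<in> B s" "s \<in> S" for g s
  proof -
    have "g \<inter> S = {s}" using that card2[of g] by (auto simp: B_def card_2_iff)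
    then show ?thesis by (simp add: col_def)
  qed
  have hit: "\<exists>g\<in>B s. h s g = n" if "n < card (B s)" for s n
  proof -
    have "n \<in> h s ` B s" using h[of s] that by (simp add: bij_betw_def)
    then show ?thesis by blast
  qed
  have main: "\<exists>g\<in>gedges G. g \<inter> {u, v} \<noteq> {} \<and> \<not> g \<subseteq> S \<and> col g = i"
    if uv: "{u, v} \<in> gedges G" "u \<in> S" "v \<in> S" "c u" "\<not> c v" and i: "i < k" for u v i
  proof -
    have "enat k \<le> enat (outer_degree G S u + outer_degree G S v)"
      using zeta_le_outer_degree[OF G uv(1), of S] uv by (intro order_trans[OF k]) simp
    then have "enat k \<le> enat (card (B u) + card (B v))"
      unfolding outer_degree_eq[OF fin] B_def .
    then have "k \<le> card (B u) + card (B v)" by simp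
    show ?thesis
    proof (cases "i < card (B u)")
      case True
      then obtain g where g: "g \<in> B u" "h u g = i" using hit by blast
      then have "col g = i" using col uv by simp
      then show ?thesis using g(1) by (auto simp: B_def)
    next
      case False
      \<comment> \<open>Colour \<open>i\<close> is missing at \<open>u\<close> only if
        \<open>i\<close> is at least \<open>card (B u)\<close>; counted from the top, it is then
        among the first \<open>card (B v)\<close> colours.\<close>
      then have "k - 1 - i < card (B v)" using i \<open>k \<le> card (B u) + card (B v)\<close> by linarith
      then obtain g where g: "g \<in> B v" "h v g = k - 1 - i" using hit by blast
      then have "col g = i" using col uv i by simp
      then show ?thesis using g(1) by (auto simp: B_def)
    qed
  qed
  have "\<exists>g\<in>gedges G. g \<inter> e \<noteq> {} \<and> \<not> g \<subseteq> S \<and> col g = i"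
    if e: "e \<in> gedges G" "e \<subseteq> S" and i: "i < k" for e i
  proof -
    obtain u v where uv: "e = {u, v}" using card2[OF e(1)] by (auto simp: card_2_iff)
    show ?thesis
    proof (cases "c u")
      case True
      then have "\<not> c v" using c[of u v] e uv by blast
      then show ?thesis using main[of u v i] True e uv i by blast
    next
      case False
      then have "c v" using c[of u v] e uv by blast
      moreover have "{u, v} = {v, u}" by blast
      ultimately show ?thesis using main[of v u i] False e uv i by simp
    qed
  qed
  then show ?thesis by blast
qed

section \<open>Trees in the line graph from trees of \<open>G - S\<close>\<close>

lemma tree_incident_edge:
  assumes "is_gtree T" "x \<in> gverts T" "y \<in> gverts T" "x \<noteq> y"
  shows "\<exists>e\<in>gedges T. x \<in> e"
proof -
  have "(x, y) \<in> (adj_rel (gedges T))\<^sup>*"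
    using gconnectedD assms by (auto simp: is_gtree_def)
  then obtain z where "(x, z) \<in> adj_rel (gedges T)" using assms(4) by (meson converse_rtranclE)
  then show ?thesis by auto
qed

text \<open>Settles \<open>k = 1\<close>, where a single spanning tree of \<open>L(G)\<close>
  suffices. Every edge of \<open>G\<close> has an end reachable from a root outside
  \<open>S\<close>; an edge inside \<open>S\<close> is reached through a boundary edge.\<close>

lemma connected_line_graph:
  assumes G: "fin_simple_graph G" and S: "star_subset G S"
    and k: "1 \<le> tau (delete_verts G S)" "1 \<le> zeta G S"
  shows "gconnected (line_graph G)"
proof -
  let ?D = "delete_verts G S"
  have card2: "card e = 2" and sub: "e \<subseteq> gverts G" if "e \<in> gedges G" for e
    using G that by (simp_all add: fin_simple_graph_def)
  have fin: "finite (gedges G)" by (rule fin_simple_graph_finite_edges[OF G])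
  then have "finite (gedges ?D)" by (simp add: delete_verts_def)
  from edge_disjoint_trees_family[OF this k(1)]
  obtain T where T: "is_spanning_tree T ?D" by (metis less_one)
  obtain col where col: "\<forall>e\<in>gedges G. e \<subseteq> S \<longrightarrow>
      (\<forall>i<1. \<exists>g\<in>gedges G. g \<inter> e \<noteq> {} \<and> \<not> g \<subseteq> S \<and> col g = (i::nat))"
    using boundary_colouring[OF G S, of 1] k(2) by (auto simp: one_enat_def)
  obtain r where r: "r \<in> gverts G - S" using S by (auto simp: star_subset_def)
  let ?R = "(adj_rel (gedges G))\<^sup>*"
  have outside: "(r, x) \<in> ?R" if "x \<in> gverts G - S" for x
  proof -
    have "(r, x) \<in> (adj_rel (gedges T))\<^sup>*"
      using T gconnectedD[of T r x] r that
      by (auto simp: is_spanning_tree_def is_gtree_def delete_verts_def)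
    moreover have "gedges T \<subseteq> gedges G" using T by (auto simp: is_spanning_tree_def delete_verts_def)
    ultimately show ?thesis using adj_rel_mono by blast
  qed
  have reach: "\<exists>x\<in>e. (r, x) \<in> ?R" if e: "e \<in> gedges G" for e
  proof (cases "e \<subseteq> S")
    case False
    then show ?thesis using outside sub[OF e] by blast
  next
    case True
    then obtain g where g: "g \<in> gedges G" "g \<inter> e \<noteq> {}" "\<not> g \<subseteq> S" using col e by (metis less_one)
    then obtain x y where xy: "x \<in> g" "x \<in> e" "y \<in> g" "y \<notin> S" by blast
    then have "x \<noteq> y" using True by blast
    then have "g = {x, y}" using xy card2[OF g(1)] by (auto simp: card_2_iff)
    then have "(y, x) \<in> adj_rel (gedges G)" using g(1) by (simp add: insert_commute)
    moreover have "(r, y) \<in> ?R" using outside[of y] xy sub[OF g(1)] by blast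
    ultimately show ?thesis using xy(2) by (meson rtrancl.rtrancl_into_rtrancl)
  qed
  have ind: "gedges (induced_graph (line_graph G) (gedges G)) = gedges (line_graph G)"
    by (auto simp: induced_graph_def line_graph_def)
  show ?thesis
  proof (subst gconnected_iff[OF line_graph_finite_simple(2)[OF G]], intro ballI)
    fix e f assume "e \<in> gverts (line_graph G)" "f \<in> gverts (line_graph G)"
    then have ef: "e \<in> gedges G" "f \<in> gedges G" by (auto simp: line_graph_def)
    obtain x y where "x \<in> e" "y \<in> f" "(r, x) \<in> ?R" "(r, y) \<in> ?R" using reach ef by blast
    moreover from this have "(x, y) \<in> ?R" by (meson adj_rtrancl_sym rtrancl_trans)
    ultimately show "(e, f) \<in> (adj_rel (gedges (line_graph G)))\<^sup>*"
      using line_graph_walk[of "gedges G" G e x y f] ef ind by simp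
  qed
qed

lemma completely_independent_trees_line_graph:
  assumes G: "fin_simple_graph G" and S: "star_subset G S"
    and k: "2 \<le> k" "k \<le> tau (delete_verts G S)" "enat k \<le> zeta G S"
  shows "\<exists>F. completely_independent_trees (line_graph G) F \<and> card F = k"
proof -
  let ?D = "delete_verts G S"
  define W where "W = gverts G - S"
  have card2: "card e = 2" and sub: "e \<subseteq> gverts G" if "e \<in> gedges G" for e
    using G that by (simp_all add: fin_simple_graph_def)
  have fin: "finite (gedges G)" by (rule fin_simple_graph_finite_edges[OF G])
  then have "finite (gedges ?D)" by (simp add: delete_verts_def)
  from edge_disjoint_trees_family[OF this k(2)]
  obtain T where T: "\<And>i. i < k \<Longrightarrow> is_spanning_tree (T i) ?D"
    and T_disj: "\<And>i j. i < k \<Longrightarrow> j < k \<Longrightarrow> i \<noteq> j \<Longrightarrow> gedges (T i) \<inter> gedges (T j) = {}"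
    and inj: "inj_on T {..<k}" by blast
  have TV: "gverts (T i) = W" and TE: "gedges (T i) \<subseteq> gedges G"
    and TS: "\<And>e. e \<in> gedges (T i) \<Longrightarrow> e \<subseteq> W" and tree: "is_gtree (T i)" if "i < k" for i
    using T[OF that] sub by (auto simp: is_spanning_tree_def delete_verts_def W_def)
  from boundary_colouring[OF G S k(3)]
  obtain col where "\<forall>e\<in>gedges G. e \<subseteq> S \<longrightarrow>
      (\<forall>i<k. \<exists>g\<in>gedges G. g \<inter> e \<noteq> {} \<and> \<not> g \<subseteq> S \<and> col g = i)" by (rule exE)
  then have col: "\<exists>g\<in>gedges G. g \<inter> e \<noteq> {} \<and> \<not> g \<subseteq> S \<and> col g = i"
    if "e \<in> gedges G" "e \<subseteq> S" "i < k" for e i using that by simp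
  obtain r where r: "r \<in> W" using S by (auto simp: star_subset_def W_def)
  \<comment> \<open>On a single vertex all trees \<open>T i\<close> would coincide, but there are at
    least two distinct ones. Hence every vertex of \<open>W\<close> lies on an edge of each
    tree.\<close>
  have "\<exists>s\<in>W. s \<noteq> r"
  proof (rule ccontr)
    assume "\<not> (\<exists>s\<in>W. s \<noteq> r)"
    then have W: "W \<subseteq> {r}" by blast
    have "gedges (T i) = {}" if i: "i < k" for i
    proof (rule ccontr)
      assume "gedges (T i) \<noteq> {}"
      then obtain e where e: "e \<in> gedges (T i)" by blast
      then have "e \<subseteq> {r}" using TS[OF i] W by blast
      then have "card e \<le> 1" using card_mono[of "{r}" e] by simp
      then show False using card2 TE[OF i] e by fastforce
    qed
    then have "T 0 = T 1" using TV[of 0] TV[of 1] k(1) by simp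
    then show False using inj_onD[OF inj, of 0 1] k(1) by simp
  qed
  then obtain s where s: "s \<in> W" "s \<noteq> r" by blast
  have incident: "\<exists>f\<in>gedges (T i). w \<in> f" if "i < k" "w \<in> W" for i w
    using tree_incident_edge[OF tree[OF that(1)], of w r]
      tree_incident_edge[OF tree[OF that(1)], of w s] TV[OF that(1)] that(2) r s by metis
  have "\<exists>c. (\<forall>e\<in>gedges (T i). c e \<in> e) \<and> c ` gedges (T i) = W - {r}" if i: "i < k" for i
    using tree_child_map[OF tree[OF i], of r] TS[OF i] TE[OF i] TV[OF i] r card2
    by (auto simp: edges_within_def subset_iff)
  then obtain c where c: "\<And>i e. i < k \<Longrightarrow> e \<in> gedges (T i) \<Longrightarrow> c i e \<in> e"
    and c_im: "\<And>i. i < k \<Longrightarrow> c i ` gedges (T i) = W - {r}" by metis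
  \<comment> \<open>The class of \<open>T i\<close> also receives the boundary edges of colour
    \<open>i\<close>, each attached to the tree at its end in \<open>W\<close>.\<close>
  define V where "V i = gedges (T i) \<union> {g \<in> gedges G. g \<inter> S \<noteq> {} \<and> \<not> g \<subseteq> S \<and> col g = i}" for i
  have VG: "V i \<subseteq> gedges G" if "i < k" for i using TE[OF that] by (auto simp: V_def)
  have V_disj: "V i \<inter> V j = {}" if "i < k" "j < k" "i \<noteq> j" for i j
    using T_disj[OF that] TS[OF that(1)] TS[OF that(2)] that(3) by (auto simp: V_def W_def)
  have V_W: "e \<inter> W \<noteq> {}" if "i < k" "e \<in> V i" for i e
  proof -
    have "e \<noteq> {}" using card2[of e] VG that by fastforce
    then show ?thesis using that TS[of i e] sub[of e] by (auto simp: V_def W_def)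
  qed
  have V_conn: "gconnected (induced_graph (line_graph G) (V i))" if i: "i < k" for i
  proof -
    let ?L = "induced_graph (line_graph G) (V i)"
    obtain e0 where e0: "e0 \<in> gedges (T i)" "r \<in> e0" using incident[OF i r] by blast
    have tree_part: "(e0, f) \<in> (adj_rel (gedges ?L))\<^sup>*" if f: "f \<in> gedges (T i)" for f
    proof -
      obtain y where y: "y \<in> f" using card2[of f] TE[OF i] f by fastforce
      then have "(r, y) \<in> (adj_rel (gedges (T i)))\<^sup>*"
        using gconnectedD[of "T i" r y] tree[OF i] TV[OF i] TS[OF i f] r by (auto simp: is_gtree_def)
      then have "(r, y) \<in> (adj_rel (V i))\<^sup>*" using adj_rel_mono[of "gedges (T i)" "V i"] by (auto simp: V_def)
      then show ?thesis
        using line_graph_walk[OF VG[OF i], of e0 r y f] e0 f y by (simp add: V_def)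
    qed
    have "(e0, f) \<in> (adj_rel (gedges ?L))\<^sup>*" if f: "f \<in> V i" for f
    proof (cases "f \<in> gedges (T i)")
      case False
      obtain w where w: "w \<in> f" "w \<in> W" using V_W[OF i f] by blast
      obtain g where g: "g \<in> gedges (T i)" "w \<in> g" using incident[OF i w(2)] by blast
      then have "(g, f) \<in> adj_rel (gedges ?L)"
        using line_adjacent[of g "V i" f G] VG[OF i] f False w by (auto simp: V_def)
      then show ?thesis using tree_part[OF g(1)] by (meson rtrancl.rtrancl_into_rtrancl)
    qed (rule tree_part)
    then show ?thesis
      by (intro gconnectedI_root[of _ e0]) (auto simp: edges_within_def induced_graph_def)
  qed
  \<comment> \<open>Admissible neighbours \<open>f\<close> of \<open>e\<close> in class
    \<open>i\<close>. An edge meeting \<open>W\<close> must choose a tree edge, so boundary edges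
    are chosen only by edges inside \<open>S\<close>, which belong to no class. For \<open>e\<close>
    in \<open>T j\<close>, the rule is equal child ends if \<open>i < j\<close>, and contact at the
    parent end \<open>e - {c j e}\<close> if \<open>j < i\<close>.\<close>
  define P where "P i e f \<longleftrightarrow> f \<in> V i \<and> f \<inter> e \<noteq> {} \<and> (e \<inter> W \<noteq> {} \<longrightarrow> f \<in> gedges (T i)) \<and>
    (\<forall>j<k. e \<in> gedges (T j) \<longrightarrow>
      (i < j \<longrightarrow> c i f = c j e) \<and> (j < i \<longrightarrow> f \<inter> (e - {c j e}) \<noteq> {}))" for i e f
  have "\<exists>f. P i e f" if i: "i < k" and e: "e \<in> gedges G - V i" for i e
  proof (cases "\<exists>j<k. e \<in> gedges (T j)")
    case True
    then obtain j where j: "j < k" "e \<in> gedges (T j)" by blast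
    then have "j \<noteq> i" using e by (auto simp: V_def)
    have uniq: "j' = j" if "j' < k" "e \<in> gedges (T j')" for j' using T_disj[of j j'] j that by blast
    show ?thesis
    proof (cases "i < j")
      case True
      \<comment> \<open>All trees have the same root, so the child end of \<open>e\<close> is a
        non-root vertex and thus the child end of some edge of \<open>T i\<close>.\<close>
      have "c j e \<in> c i ` gedges (T i)" using c_im i j by blast
      then obtain f where f: "f \<in> gedges (T i)" "c i f = c j e" by force
      then have "f \<inter> e \<noteq> {}" using c[OF i f(1)] c[OF j] by auto
      then have "P i e f" using f uniq True by (auto simp: P_def V_def)
      then show ?thesis ..
    next
      case False
      have "card e = 2" using card2 e by blast
      then have "\<exists>w. w \<in> e \<and> w \<noteq> c j e" by (metis card_2_iff insertI1 insertI2)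
      then obtain w where w: "w \<in> e" "w \<noteq> c j e" by blast
      then obtain f where f: "f \<in> gedges (T i)" "w \<in> f" using incident[OF i] TS[OF j] by blast
      then have "P i e f" using w uniq False by (auto simp: P_def V_def)
      then show ?thesis ..
    qed
  next
    case no_tree: False
    show ?thesis
    proof (cases "e \<inter> W = {}")
      case True
      then have "e \<subseteq> S" using sub e by (auto simp: W_def)
      then obtain g where "g \<in> gedges G" "g \<inter> e \<noteq> {}" "\<not> g \<subseteq> S" "col g = i" using col[of e i] e i by blast
      then have "P i e g" using True no_tree \<open>e \<subseteq> S\<close> by (auto simp: P_def V_def)
      then show ?thesis ..
    next
      case False
      then obtain w where w: "w \<in> e" "w \<in> W" by blast
      then obtain f where "f \<in> gedges (T i)" "w \<in> f" using incident[OF i] by blast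
      then have "P i e f" using w no_tree by (auto simp: P_def V_def)
      then show ?thesis ..
    qed
  qed
  then have "\<forall>i e. \<exists>f. i < k \<and> e \<in> gedges G - V i \<longrightarrow> P i e f" by blast
  then obtain a where a: "\<And>i e. i < k \<Longrightarrow> e \<in> gedges G - V i \<Longrightarrow> P i e (a i e)" by metis
  have no_mutual: False
    if ij: "i < k" "j < k" "i < j" and ef: "e \<in> V j" "f \<in> V i" "a i e = f" "a j f = e" for i j e f
  proof -
    have "V i \<inter> V j = {}" using V_disj ij by simp
    then have P: "P i e f" "P j f e" using a[of i e] a[of j f] ij ef VG[OF ij(1)] VG[OF ij(2)] by auto
    \<comment> \<open>Members of classes meet \<open>W\<close>, so a mutual choice can only involve
      two tree edges.\<close>
    have T': "f \<in> gedges (T i)" "e \<in> gedges (T j)"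
      using P V_W[OF ij(1) ef(2)] V_W[OF ij(2) ef(1)] by (auto simp: P_def)
    then have z: "c i f = c j e" and "e \<inter> (f - {c i f}) \<noteq> {}"
      using P ij unfolding P_def by blast+
    then obtain w where w: "w \<in> e" "w \<in> f" "w \<noteq> c i f" by blast
    have "c i f \<in> e" "c i f \<in> f" using c[OF ij(1) T'(1)] c[OF ij(2) T'(2)] z by auto
    \<comment> \<open>By the two rules \<open>e\<close> and \<open>f\<close> share the child end of
      \<open>f\<close> and also its parent end; in a simple graph they coincide.\<close>
    then have "e = f" using card_two_eq[of e f w "c i f"] w T' TE[OF ij(1)] TE[OF ij(2)] card2 by blast
    then show False using T' T_disj ij by blast
  qed
  obtain e1 e2 where e12: "e1 \<in> gedges (T 0)" "e2 \<in> gedges (T 1)"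
    using incident[of 0 r] incident[of 1 r] r k(1) by auto
  show ?thesis
  proof (rule completely_independent_trees_from_classes[where V = V and a = a])
    show "finite (gedges (line_graph G))" "edges_within (line_graph G)"
      "\<And>e. e \<in> gedges (line_graph G) \<Longrightarrow> card e = 2"
      using line_graph_finite_simple[OF G] by blast+
    show "e1 \<in> gverts (line_graph G)" "e2 \<in> gverts (line_graph G)"
      using e12 TE[of 0] TE[of 1] k(1) by (auto simp: line_graph_def)
    show "e1 \<noteq> e2" using e12 T_disj[of 0 1] k(1) by auto
    show "V i \<subseteq> gverts (line_graph G)" if "i < k" for i
      using VG[OF that] by (simp add: line_graph_def)
    show "a i e \<in> V i \<and> {e, a i e} \<in> gedges (line_graph G)"
      if "i < k" "e \<in> gverts (line_graph G) - V i" for i e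
    proof -
      have e: "e \<in> gedges G" "e \<notin> V i" using that by (auto simp: line_graph_def)
      then have "a i e \<in> V i" "a i e \<inter> e \<noteq> {}" using a[of i e] that(1) by (auto simp: P_def)
      moreover from this have "a i e \<in> gedges G" "a i e \<noteq> e" using VG[OF that(1)] e by auto
      ultimately show ?thesis using e by (auto simp: line_graph_def)
    qed
    show False if "i < k" "j < k" "i \<noteq> j" "e \<in> V j" "f \<in> V i" "a i e = f" "a j f = e" for i j e f
      using no_mutual[of i j e f] no_mutual[of j i f e] that by (meson linorder_neqE_nat)
  qed (use V_disj V_conn in blast)+
qed

section \<open>The bound for \<open>tau'\<close>\<close>

lemma finite_tau'_values:
  assumes "fin_simple_graph G"
  shows "finite {min (enat (tau (delete_verts G S))) (zeta G S) | S. star_subset G S}"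
proof (rule finite_subset)
  show "{min (enat (tau (delete_verts G S))) (zeta G S) | S. star_subset G S}
      \<subseteq> (\<lambda>S. min (enat (tau (delete_verts G S))) (zeta G S)) ` Pow (gverts G)"
    by (auto simp: star_subset_def)
qed (use assms in \<open>simp add: fin_simple_graph_def\<close>)

lemma tau'_ge:
  assumes "fin_simple_graph G" "star_subset G S"
  shows "min (enat (tau (delete_verts G S))) (zeta G S) \<le> tau' G"
  unfolding tau'_def using finite_tau'_values[OF assms(1)] assms(2) by (intro Max_ge) auto

lemma tau'_le_tau_star_line_graph:
  assumes G: "fin_simple_graph G" and ne: "gverts G \<noteq> {}"
  shows "tau' G \<le> enat (tau_star (line_graph G))"
proof -
  have bound: "min (enat (tau (delete_verts G S))) (zeta G S) \<le> enat (tau_star (line_graph G))"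
    if S: "star_subset G S" for S
  proof -
    let ?m = "min (enat (tau (delete_verts G S))) (zeta G S)"
    \<comment> \<open>\<open>zeta\<close> may be infinite, but its minimum with the finite
      \<open>tau\<close> is a natural number.\<close>
    obtain k where k: "?m = enat k" by (cases ?m) (auto simp: min_def split: if_splits)
    have le: "enat k \<le> enat (tau (delete_verts G S))" "enat k \<le> zeta G S"
      unfolding k[symmetric] by simp_all
    have "\<exists>F. completely_independent_trees (line_graph G) F \<and> card F = k"
    proof -
      consider "k = 0" | "k = 1" | "2 \<le> k" by linarith
      then show ?thesis
      proof cases
        case 1
        then show ?thesis by (intro exI[of _ "{}"]) (simp add: completely_independent_trees_def)
      next
        case 2
        then have "gconnected (line_graph G)"
          using connected_line_graph[OF G S] le by (simp add: one_enat_def)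
        then obtain T where "is_spanning_tree T (line_graph G)"
          using spanning_tree_exists line_graph_finite_simple[OF G] by blast
        then show ?thesis
          using 2 by (intro exI[of _ "{T}"]) (simp add: completely_independent_trees_def)
      next
        case 3
        then show ?thesis using completely_independent_trees_line_graph[OF G S] le by simp
      qed
    qed
    then show ?thesis using tau_star_ge[OF line_graph_finite_simple(1)[OF G]] k by force
  qed
  \<comment> \<open>This makes the set of values nonempty, so that its maximum can be bounded
    elementwise.\<close>
  have "star_subset G {}" using ne by (auto simp: star_subset_def)
  then show ?thesis
    unfolding tau'_def using bound by (subst Max_le_iff[OF finite_tau'_values[OF G]]) auto
qed

section \<open>Edge counts and sharpness\<close>

text \<open>The child map sends the edges onto the non-root vertices.\<close>

lemma tree_card_edges_ge:
  assumes "is_gtree T" "edges_within T" "\<And>e. e \<in> gedges T \<Longrightarrow> card e = 2" "finite (gedges T)"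
  shows "card (gverts T) - 1 \<le> card (gedges T)"
proof (cases "gverts T = {}")
  case False
  then obtain r where r: "r \<in> gverts T" by blast
  then obtain c where "c ` gedges T = gverts T - {r}" using tree_child_map[OF assms(1-3)] by blast
  then have "card (gverts T - {r}) \<le> card (gedges T)" using card_image_le[OF assms(4), of c] by simp
  then show ?thesis using r by (simp add: card_Diff_singleton_if)
qed simp

text \<open>A common edge \<open>{u, v}\<close> would be the \<open>u\<close>-\<open>v\<close> path
  in both trees.\<close>

lemma completely_independent_trees_edge_disjoint:
  assumes "completely_independent_trees G F" "T \<in> F" "T' \<in> F" "T \<noteq> T'"
    "edges_within G" "\<And>e. e \<in> gedges G \<Longrightarrow> card e = 2"
  shows "gedges T \<inter> gedges T' = {}"
proof (rule ccontr)
  assume "gedges T \<inter> gedges T' \<noteq> {}"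
  then obtain e where e: "e \<in> gedges T" "e \<in> gedges T'" by blast
  have span: "is_spanning_tree T G" "is_spanning_tree T' G"
    using assms by (auto simp: completely_independent_trees_def)
  then have "e \<in> gedges G" using e by (auto simp: is_spanning_tree_def)
  then have "card e = 2" "e \<subseteq> gverts G" using assms(5,6) by (auto simp: edges_within_def)
  then obtain u v where uv: "e = {u, v}" "u \<noteq> v" "u \<in> gverts G" "v \<in> gverts G"
    by (auto simp: card_2_iff)
  have "gpath_edges [u, v] = {e}" using uv by (simp add: gpath_edges_Cons)
  moreover have "is_gpath T u [u, v] v" "is_gpath T' u [u, v] v"
    using e uv span by (auto simp: is_gpath_def gpath_edges_Cons is_spanning_tree_def)
  moreover have "pairwise (\<lambda>T T'. \<forall>p q. is_gpath T u p v \<and> is_gpath T' u q v \<longrightarrow>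
      gpath_edges p \<inter> gpath_edges q = {} \<and> set p \<inter> set q \<subseteq> {u, v}) F"
    using assms(1) uv(2-4) by (simp add: completely_independent_trees_def)
  ultimately have "gpath_edges [u, v] \<inter> gpath_edges [u, v] = {}"
    using assms(2-4) unfolding pairwise_def by meson
  then show False using \<open>gpath_edges [u, v] = {e}\<close> by simp
qed

text \<open>The trees occupy disjoint edge sets, each with at least
  \<open>card (gverts G) - 1\<close> edges. An infinite \<open>F\<close> has cardinality 0 by
  convention.\<close>

lemma completely_independent_trees_card_bound:
  assumes F: "completely_independent_trees G F" and fin: "finite (gedges G)"
    and wf: "edges_within G" "\<And>e. e \<in> gedges G \<Longrightarrow> card e = 2"
  shows "card F * (card (gverts G) - 1) \<le> card (gedges G)"
proof (cases "finite F")
  case True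
  have span: "gverts T = gverts G" "gedges T \<subseteq> gedges G" "is_gtree T" if "T \<in> F" for T
    using F that by (auto simp: completely_independent_trees_def is_spanning_tree_def)
  have finT: "finite (gedges T)" if "T \<in> F" for T using span(2)[OF that] fin finite_subset by blast
  have "card (gverts G) - 1 \<le> card (gedges T)" if "T \<in> F" for T
  proof -
    have "edges_within T" using wf(1) span[OF that] by (auto simp: edges_within_def)
    then show ?thesis using tree_card_edges_ge[OF span(3)] finT wf(2) span[OF that] that by force
  qed
  then have "card F * (card (gverts G) - 1) \<le> (\<Sum>T\<in>F. card (gedges T))"
    using sum_bounded_below[of F "card (gverts G) - 1" "\<lambda>T. card (gedges T)"] by simp
  also have "\<dots> = card (\<Union>T\<in>F. gedges T)"
    using True finT completely_independent_trees_edge_disjoint[OF F _ _ _ wf]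
    by (subst card_UN_disjoint) auto
  also have "\<dots> \<le> card (gedges G)" using fin span(2) by (intro card_mono) auto
  finally show ?thesis .
qed simp

text \<open>Disjoint connecting edge sets suffice, since a spanning tree can be chosen inside each.
  The two vertices \<open>x\<close> and \<open>y\<close> force edges to exist, so the two trees
  differ.\<close>

lemma two_le_tau:
  assumes "finite (gedges G)" "edges_within G" "E1 \<subseteq> gedges G" "E2 \<subseteq> gedges G" "E1 \<inter> E2 = {}"
    "gconnected \<lparr>gverts = gverts G, gedges = E1\<rparr>" "gconnected \<lparr>gverts = gverts G, gedges = E2\<rparr>"
    "x \<in> gverts G" "y \<in> gverts G" "x \<noteq> y"
  shows "2 \<le> tau G"
proof -
  have "\<exists>T. is_spanning_tree T \<lparr>gverts = gverts G, gedges = E\<rparr>"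
    if "E \<subseteq> gedges G" "gconnected \<lparr>gverts = gverts G, gedges = E\<rparr>" for E
    using assms(1,2) that finite_subset by (intro spanning_tree_exists) (auto simp: edges_within_def)
  then obtain T1 T2 where T: "is_spanning_tree T1 \<lparr>gverts = gverts G, gedges = E1\<rparr>"
    "is_spanning_tree T2 \<lparr>gverts = gverts G, gedges = E2\<rparr>" using assms by meson
  then have "gedges T1 \<noteq> {}" "gedges T1 \<inter> gedges T2 = {}"
    using tree_incident_edge[of T1 x y] assms by (auto simp: is_spanning_tree_def)
  then have "T1 \<noteq> T2" by auto
  moreover have "edge_disjoint_trees G {T1, T2}"
    using T assms \<open>gedges T1 \<inter> gedges T2 = {}\<close>
    by (auto simp: edge_disjoint_trees_def is_spanning_tree_def pairwise_def)
  ultimately show ?thesis using tau_ge[OF assms(1), of "{T1, T2}"] by simp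
qed

lemma line_graph_edges_subset:
  assumes "\<forall>e\<in>gedges G. \<forall>f\<in>gedges G. e \<noteq> f \<longrightarrow> e \<inter> f \<noteq> {} \<longrightarrow> {e, f} \<in> X"
  shows "gedges (line_graph G) \<subseteq> X"
  using assms unfolding line_graph_def by auto

section \<open>The complete graph on four vertices, without and with a pendant edge\<close>

definition k4 :: "nat ugraph" where
  "k4 = \<lparr>gverts = {0, 1, 2, 3},
         gedges = {{0, 1}, {0, 2}, {0, 3}, {1, 2}, {1, 3}, {2, 3}}\<rparr>"

definition k4_pendant :: "nat ugraph" where
  "k4_pendant = \<lparr>gverts = insert 4 (gverts k4), gedges = insert {3, 4} (gedges k4)\<rparr>"

lemma fin_simple_k4: "fin_simple_graph k4"
  by (simp add: fin_simple_graph_def k4_def)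

lemma fin_simple_k4_pendant: "fin_simple_graph k4_pendant"
  by (simp add: fin_simple_graph_def k4_pendant_def k4_def)

lemma tau_k4_ge: "2 \<le> tau k4"
\<comment> \<open>The Hamiltonian paths 0-1-2-3 and 1-3-0-2 partition the six edges.\<close>
proof (rule two_le_tau[where ?E1.0 = "{{0, 1}, {1, 2}, {2, 3}}"
      and ?E2.0 = "{{1, 3}, {0, 3}, {0, 2}}" and x = 0 and y = 1])
  show "gconnected \<lparr>gverts = gverts k4, gedges = {{0, 1}, {1, 2}, {2, 3}}\<rparr>"
  proof (rule gconnectedI_root[where r = 0])
    let ?R = "(adj_rel {{0, 1}, {1, 2}, {2, 3 :: nat}})\<^sup>*"
    have 1: "(0, 1) \<in> ?R" by (simp add: r_into_rtrancl)
    have 2: "(0, 2) \<in> ?R" by (rule rtrancl_into_rtrancl[OF 1]) simp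
    have 3: "(0, 3) \<in> ?R" by (rule rtrancl_into_rtrancl[OF 2]) simp
    show "(0, u) \<in> (adj_rel (gedges \<lparr>gverts = gverts k4, gedges = {{0, 1}, {1, 2}, {2, 3}}\<rparr>))\<^sup>*"
      if "u \<in> gverts \<lparr>gverts = gverts k4, gedges = {{0, 1}, {1, 2}, {2, 3}}\<rparr>" for u
      using that 1 2 3 by (auto simp: k4_def)
  qed (auto simp: edges_within_def k4_def)
  show "gconnected \<lparr>gverts = gverts k4, gedges = {{1, 3}, {0, 3}, {0, 2}}\<rparr>"
  proof (rule gconnectedI_root[where r = 0])
    let ?R = "(adj_rel {{1, 3}, {0, 3}, {0, 2 :: nat}})\<^sup>*"
    have 1: "(0, 2) \<in> ?R" by (simp add: r_into_rtrancl)
    have 2: "(0, 3) \<in> ?R" by (simp add: r_into_rtrancl)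
    have 3: "(0, 1) \<in> ?R" by (rule rtrancl_into_rtrancl[OF 2]) (simp add: insert_commute)
    show "(0, u) \<in> (adj_rel (gedges \<lparr>gverts = gverts k4, gedges = {{1, 3}, {0, 3}, {0, 2}}\<rparr>))\<^sup>*"
      if "u \<in> gverts \<lparr>gverts = gverts k4, gedges = {{1, 3}, {0, 3}, {0, 2}}\<rparr>" for u
      using that 1 2 3 by (auto simp: k4_def)
  qed (auto simp: edges_within_def k4_def)
qed (auto simp: k4_def edges_within_def doubleton_eq_iff)

lemma card_line_graph_k4: "card (gverts (line_graph k4)) = 6" "card (gedges (line_graph k4)) \<le> 12"
proof -
  show "card (gverts (line_graph k4)) = 6"
    by (simp add: line_graph_def k4_def doubleton_eq_iff)
  \<comment> \<open>Row by row, the three pairs of edges meeting at vertex 0, 1, 2 and 3.\<close>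
  let ?xs = "[{{0, 1}, {0, 2}}, {{0, 1}, {0, 3}}, {{0, 2}, {0, 3}},
      {{0, 1}, {1, 2}}, {{0, 1}, {1, 3}}, {{1, 2}, {1, 3}},
      {{0, 2}, {1, 2}}, {{0, 2}, {2, 3}}, {{1, 2}, {2, 3}},
      {{0, 3}, {1, 3}}, {{0, 3}, {2, 3}}, {{1, 3}, {2, 3}}] :: nat set set list"
  have "\<forall>e\<in>gedges k4. \<forall>f\<in>gedges k4. e \<noteq> f \<longrightarrow> e \<inter> f \<noteq> {} \<longrightarrow> {e, f} \<in> set ?xs"
    unfolding k4_def by (simp add: doubleton_eq_iff)
  then have "gedges (line_graph k4) \<subseteq> set ?xs" by (rule line_graph_edges_subset)
  then have "card (gedges (line_graph k4)) \<le> card (set ?xs)" by (intro card_mono) simp_all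
  also have "\<dots> \<le> length ?xs" by (rule card_length)
  finally show "card (gedges (line_graph k4)) \<le> 12" by simp
qed

lemma card_line_graph_k4_pendant:
  "card (gverts (line_graph k4_pendant)) = 7" "card (gedges (line_graph k4_pendant)) \<le> 15"
proof -
  show "card (gverts (line_graph k4_pendant)) = 7"
    by (simp add: line_graph_def k4_pendant_def k4_def doubleton_eq_iff)
  \<comment> \<open>The last row adds the pairs formed by the pendant edge and the three other edges
    at vertex 3.\<close>
  let ?xs = "[{{0, 1}, {0, 2}}, {{0, 1}, {0, 3}}, {{0, 2}, {0, 3}},
      {{0, 1}, {1, 2}}, {{0, 1}, {1, 3}}, {{1, 2}, {1, 3}},
      {{0, 2}, {1, 2}}, {{0, 2}, {2, 3}}, {{1, 2}, {2, 3}},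
      {{0, 3}, {1, 3}}, {{0, 3}, {2, 3}}, {{1, 3}, {2, 3}},
      {{0, 3}, {3, 4}}, {{1, 3}, {3, 4}}, {{2, 3}, {3, 4}}] :: nat set set list"
  have "\<forall>e\<in>gedges k4_pendant. \<forall>f\<in>gedges k4_pendant. e \<noteq> f \<longrightarrow> e \<inter> f \<noteq> {} \<longrightarrow> {e, f} \<in> set ?xs"
    unfolding k4_pendant_def k4_def by (simp add: doubleton_eq_iff)
  then have "gedges (line_graph k4_pendant) \<subseteq> set ?xs" by (rule line_graph_edges_subset)
  then have "card (gedges (line_graph k4_pendant)) \<le> card (set ?xs)" by (intro card_mono) simp_all
  also have "\<dots> \<le> length ?xs" by (rule card_length)
  finally show "card (gedges (line_graph k4_pendant)) \<le> 15" by simp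
qed

text \<open>Three trees would need more edges than there are; for the two examples the counts are 12
  < 3 * 5 and 15 < 3 * 6.\<close>

lemma tau_star_line_graph_le_two:
  assumes "fin_simple_graph G" "card (gedges (line_graph G)) < 3 * (card (gverts (line_graph G)) - 1)"
  shows "tau_star (line_graph G) \<le> 2"
proof (rule tau_star_le)
  show fin: "finite (gedges (line_graph G))" by (rule line_graph_finite_simple(1)[OF assms(1)])
  fix F assume "completely_independent_trees (line_graph G) F"
  then have "card F * (card (gverts (line_graph G)) - 1) \<le> card (gedges (line_graph G))"
    using completely_independent_trees_card_bound fin line_graph_finite_simple(2,3)[OF assms(1)] by blast
  then have "card F * (card (gverts (line_graph G)) - 1) < 3 * (card (gverts (line_graph G)) - 1)"
    using assms(2) by linarith
  then show "card F \<le> 2" by simp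
qed

text \<open>The empty star-subset deletes nothing and has infinite \<open>zeta\<close>.\<close>

lemma tau_le_tau':
  assumes "fin_simple_graph G" "gverts G \<noteq> {}"
  shows "enat (tau G) \<le> tau' G"
proof -
  have "star_subset G {}" using assms(2) by (auto simp: star_subset_def)
  moreover have "delete_verts G {} = G" by (simp add: delete_verts_def)
  ultimately show ?thesis using tau'_ge[OF assms(1), of "{}"] by (simp add: zeta_def)
qed

text \<open>Both numbers equal 2: \<open>tau\<close> is at least 2 and bounds
  \<open>tau_star\<close> of the line graph from below, which is at most 2 by the edge
  count.\<close>

lemma tau_star_line_graph_k4: "tau_star (line_graph k4) = tau k4"
proof -
  have "gverts k4 \<noteq> {}" by (simp add: k4_def)
  then have "enat (tau k4) \<le> enat (tau_star (line_graph k4))"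
    using tau_le_tau' tau'_le_tau_star_line_graph fin_simple_k4 order_trans by blast
  moreover have "tau_star (line_graph k4) \<le> 2"
    using tau_star_line_graph_le_two[OF fin_simple_k4] card_line_graph_k4 by simp
  ultimately show ?thesis using tau_k4_ge by simp
qed

text \<open>Vertex 4 has only one edge, so all spanning trees share it.\<close>

lemma tau_k4_pendant_le: "tau k4_pendant \<le> 1"
proof (rule tau_le)
  show "finite (gedges k4_pendant)" by (simp add: k4_pendant_def k4_def)
  fix F assume F: "edge_disjoint_trees k4_pendant F"
  have edge: "{3, 4} \<in> gedges T" if "T \<in> F" for T
  proof -
    have T: "is_spanning_tree T k4_pendant" using F that by (simp add: edge_disjoint_trees_def)
    then obtain e where "e \<in> gedges T" "4 \<in> e"
      using tree_incident_edge[of T 4 0] by (auto simp: is_spanning_tree_def k4_pendant_def k4_def)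
    moreover have "e \<in> gedges k4_pendant" using T calculation by (auto simp: is_spanning_tree_def)
    ultimately show ?thesis by (auto simp: k4_pendant_def k4_def)
  qed
  have "T = T'" if "T \<in> F" "T' \<in> F" for T T'
    using F edge[OF that(1)] edge[OF that(2)] that unfolding edge_disjoint_trees_def pairwise_def by blast
  then show "card F \<le> 1" by (cases "finite F") (auto simp: card_le_Suc0_iff_eq)
qed

text \<open>Deleting one vertex costs nothing in the minimum defining \<open>tau'\<close>, because a
  single vertex spans no edge.\<close>

lemma star_subset_singleton:
  assumes "fin_simple_graph G" "v \<in> gverts G" "gverts G \<noteq> {v}"
  shows "star_subset G {v}" "zeta G {v} = \<infinity>"
proof -
  let ?H = "induced_graph G {v}"
  have "\<not> e \<subseteq> {v}" if "e \<in> gedges G" for e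
  proof
    assume "e \<subseteq> {v}"
    then have "card e \<le> 1" using card_mono[of "{v}" e] by simp
    then show False using assms(1) that by (auto simp: fin_simple_graph_def)
  qed
  then have no_edge: "gedges ?H = {}" by (auto simp: induced_graph_def)
  then show "zeta G {v} = \<infinity>" by (simp add: zeta_def)
  have "{w. \<exists>p. is_gpath ?H v p w} = {v}"
  proof -
    have "w = v" if "is_gpath ?H v p w" for p w
      using is_gpath_imp_rtrancl[OF that] no_edge by (simp add: adj_rel_def)
    moreover have "is_gpath ?H v [v] v" by (simp add: is_gpath_def induced_graph_def)
    ultimately show ?thesis by blast
  qed
  then have "gcomponents ?H = {induced_graph ?H {v}}"
    by (simp add: gcomponents_def induced_graph_def)
  moreover have "is_star (induced_graph ?H {v})"
  proof -
    let ?C = "induced_graph ?H {v}"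
    have C: "gverts ?C = {v}" "gedges ?C = {}" using no_edge by (auto simp: induced_graph_def)
    then have "is_gpath ?C v [v] v" by (simp add: is_gpath_def)
    then have "gconnected ?C" using C by (auto simp: gconnected_def)
    then show ?thesis using C by (simp add: is_star_def is_gtree_def is_gcycle_def gdegree_def)
  qed
  ultimately show "star_subset G {v}" using assms by (auto simp: star_subset_def)
qed

text \<open>Deleting the star-subset \<open>{4}\<close> gives back \<open>k4\<close>, hence
  \<open>tau'\<close> is at least 2; the edge count of the line graph gives the matching upper
  bound.\<close>

lemma k4_pendant_extremal:
  "tau' k4_pendant > enat (tau k4_pendant)"
  "enat (tau_star (line_graph k4_pendant)) = tau' k4_pendant"
proof -
  have "4 \<notin> e" if "e \<in> gedges k4" for e using that by (auto simp: k4_def)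
  then have "{e \<in> insert {3, 4} (gedges k4). e \<inter> {4} = {}} = gedges k4" by blast
  moreover have "insert 4 (gverts k4) - {4} = gverts k4" by (auto simp: k4_def)
  ultimately have "delete_verts k4_pendant {4} = k4" by (simp add: delete_verts_def k4_pendant_def)
  moreover have "star_subset k4_pendant {4}" "zeta k4_pendant {4} = \<infinity>"
    by (rule star_subset_singleton[OF fin_simple_k4_pendant]; simp add: k4_pendant_def k4_def)+
  ultimately have "enat (tau k4) \<le> tau' k4_pendant"
    using tau'_ge[OF fin_simple_k4_pendant, of "{4}"] by simp
  then have ge: "enat 2 \<le> tau' k4_pendant" using tau_k4_ge by (meson enat_ord_simps(1) order_trans)
  have "enat (tau k4_pendant) < enat 2" using tau_k4_pendant_le by simp
  then show "tau' k4_pendant > enat (tau k4_pendant)" using ge by (rule less_le_trans)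
  have "tau_star (line_graph k4_pendant) \<le> 2"
    using tau_star_line_graph_le_two[OF fin_simple_k4_pendant] card_line_graph_k4_pendant by simp
  then have "enat (tau_star (line_graph k4_pendant)) \<le> tau' k4_pendant"
    using ge by (meson enat_ord_simps(1) order_trans)
  moreover have "tau' k4_pendant \<le> enat (tau_star (line_graph k4_pendant))"
    by (rule tau'_le_tau_star_line_graph[OF fin_simple_k4_pendant]) (simp add: k4_pendant_def k4_def)
  ultimately show "enat (tau_star (line_graph k4_pendant)) = tau' k4_pendant" by (rule antisym)
qed

theorem theorem1:
  shows "(\<forall>G :: 'a ugraph. fin_simple_graph G \<and> gverts G \<noteq> {} \<longrightarrow>
            enat (tau_star (line_graph G)) \<ge> tau' G) \<and>
         (\<exists>G :: nat ugraph. fin_simple_graph G \<and> gverts G \<noteq> {} \<and>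
            tau' G > enat (tau G) \<and> enat (tau_star (line_graph G)) = tau' G) \<and>
         (\<exists>G :: nat ugraph. fin_simple_graph G \<and> gverts G \<noteq> {} \<and>
            tau_star (line_graph G) = tau G)"
proof (intro conjI)
  show "\<forall>G :: 'a ugraph. fin_simple_graph G \<and> gverts G \<noteq> {} \<longrightarrow>
      enat (tau_star (line_graph G)) \<ge> tau' G"
    using tau'_le_tau_star_line_graph by blast
  show "\<exists>G :: nat ugraph. fin_simple_graph G \<and> gverts G \<noteq> {} \<and>
      tau' G > enat (tau G) \<and> enat (tau_star (line_graph G)) = tau' G"
    using fin_simple_k4_pendant k4_pendant_extremal
    by (intro exI[of _ k4_pendant]) (simp add: k4_pendant_def k4_def)
  show "\<exists>G :: nat ugraph. fin_simple_graph G \<and> gverts G \<noteq> {} \<and> tau_star (line_graph G) = tau G"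
    using fin_simple_k4 tau_star_line_graph_k4 by (intro exI[of _ k4]) (simp add: k4_def)
qed

end
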